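(* Let $(X_i)_{i\ge 0}$ be a stationary centered Gaussian sequence with variance $1$ and correlations $r(j)=\mathbb E[X_kX_{k+j}]$ such that $$\sum_{i,j=1}^n r(i-j)=n^{2H}\ell(n),$$ where $H\in(0,1)$ and $\ell$ is slowly varying at infinity. Let $Z_0:=0$, $Z_n:=\sum_{i=1}^nX_i$ and $Z_n^*:=\max_{k=1,\ldots,n}Z_k$. (1) For every $a>0$ there is a constant $c>0$ such that $$c^{-1}\,n^{-(1-H)}\frac{\sqrt{\ell(n)}}{\sqrt{\log n}}\le\mathbb P(Z_n^*<0)\ \ (n\ge 2)\qquad\text{and}\qquad \mathbb P(Z_n^*\le -a)\le c\,n^{-(1-H)}\sqrt{\ell(n)}\ \ (n\ge 1).$$ (2) If moreover $\inf_{n\ge1}\sum_{i=1}^n r(i-1)=\inf_{n\ge 1}\mathbb E[Z_1Z_n]>0$, then for every $b\in\mathbb R$ there is a constant $c>0$ such that $$c^{-1}n^{-(1-H)}\frac{\sqrt{\ell(n)}}{\sqrt{\log n}}\,e^{-c\sqrt{\log n}}\le\mathbb P(Z_n^*\le b)\ \ (n\ge 2)\qquad\text{and}\qquad\mathbb P(Z_n^*\le b)\le n^{-(1-H)}\sqrt{\ell(n)}\,e^{c\sqrt{\log n}}\ \ (n\ge 1).$$ (3) If moreover the correlation function $r$ is non-negative, then for every $b\in\mathbb R$ there is a constant $c>0$ such that $$c^{-1}n^{-(1-H)}\frac{\sqrt{\ell(n)}}{\sqrt{\log n}}\le\mathbb P(Z_n^*\le b)\ \ (n\ge 2)\qquad\text{and}\qquad\mathbb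 P(Z_n^*\le b)\le c\,n^{-(1-H)}\sqrt{\ell(n)}\ \ (n\ge 1).$$
   Context: $r$ is extended to negative integers by $r(-j)=r(j)$. A function $\ell$ is slowly varying at infinity if it is eventually positive and $\ell(xt)/\ell(t)\to1$ as $t\to+\infty$ for every $x>0$. *)

theory Defs
  imports "HOL-Probability.Probability"
begin

text \<open>Since \<open>normal_density \<mu> 0\<close> is identically zero, the degenerate normal law with standard
  deviation \<open>0\<close> is the point mass at \<open>\<mu>\<close>.\<close>

definition normal_law :: "real \<Rightarrow> real \<Rightarrow> real measure" where
  "normal_law \<mu> \<sigma> =
     (if \<sigma> = 0 then return borel \<mu> else density lborel (\<lambda>x. ennreal (normal_density \<mu> \<sigma> x)))"

definition gaussian_sequence :: "'a measure \<Rightarrow> (nat \<Rightarrow> 'a \<Rightarrow> real) \<Rightarrow> bool" where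
  "gaussian_sequence M X \<longleftrightarrow>
     (\<forall>i. X i \<in> borel_measurable M) \<and>
     (\<forall>n (c :: nat \<Rightarrow> real). \<exists>\<mu> \<sigma>. 0 \<le> \<sigma> \<and>
        distr M borel (\<lambda>\<omega>. \<Sum>i<n. c i * X i \<omega>) = normal_law \<mu> \<sigma>)"

text \<open>Strict stationarity: all shifts have the same law on the product space
  \<open>\<real>\<^sup>\<nat>\<close>.\<close>

definition stationary_sequence :: "'a measure \<Rightarrow> (nat \<Rightarrow> 'a \<Rightarrow> real) \<Rightarrow> bool" where
  "stationary_sequence M X \<longleftrightarrow>
     (\<forall>k. distr M (\<Pi>\<^sub>M i\<in>UNIV. borel) (\<lambda>\<omega> i. X (i + k) \<omega>) =
          distr M (\<Pi>\<^sub>M i\<in>UNIV. borel) (\<lambda>\<omega> i. X i \<omega>))"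

definition slowly_varying :: "(real \<Rightarrow> real) \<Rightarrow> bool" where
  "slowly_varying l \<longleftrightarrow>
     (\<forall>\<^sub>F t in at_top. l t > 0) \<and> (\<forall>x>0. ((\<lambda>t. l (x * t) / l t) \<longlongrightarrow> 1) at_top)"

text \<open>The sum starts at index \<open>1\<close>: the variable \<open>X 0\<close> does not contribute.\<close>

definition partial_sum :: "(nat \<Rightarrow> 'a \<Rightarrow> real) \<Rightarrow> nat \<Rightarrow> 'a \<Rightarrow> real" where
  "partial_sum X n \<omega> = (\<Sum>i=1..n. X i \<omega>)"

text \<open>Only meaningful for \<open>n \<ge> 1\<close>; the maximum does not include \<open>partial_sum X 0 \<omega> = 0\<close>.\<close>

definition running_max :: "(nat \<Rightarrow> 'a \<Rightarrow> real) \<Rightarrow> nat \<Rightarrow> 'a \<Rightarrow> real" where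
  "running_max X n \<omega> = Max ((\<lambda>k. partial_sum X k \<omega>) ` {1..n})"

end

theory Submission
  imports Defs
begin

text \<open>
  Call \<open>k\<close> a record if \<open>Z\<^sub>j\<close> stays below \<open>Z\<^sub>k\<close> for the next \<open>n\<close> steps; by stationarity each \<open>k\<close> is a
  record with the persistence probability. If records are required to drop by at least \<open>a\<close>, then \<open>a\<close>
  times their number is at most the range of the path, whose mean is of order \<open>n\<^sup>H \<surd>l(n)\<close> by dyadic
  chaining; this is the upper bound in (1). Conversely, the drop of the future maximum over \<open>K n\<close>
  steps is at most the sum of \<open>\<bar>X\<^sub>k\<^sub>+\<^sub>1\<bar>\<close> over the records \<open>k\<close>, and the variables \<open>\<bar>X\<^sub>k\<bar>\<close> are essentially bounded
  by a multiple of \<open>\<surd>log n\<close>; this is the lower bound.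

  The barrier is moved by regressing the path on \<open>X\<^sub>1\<close>, which splits it into a multiple of \<open>X\<^sub>1\<close> and an
  independent remainder. If \<open>E[Z\<^sub>1 Z\<^sub>k]\<close> is bounded below, shifting \<open>X\<^sub>1\<close> by a constant shifts the whole path;
  the Cameron--Martin density costs the factor \<open>exp(c \<surd>log n)\<close> of (2). If \<open>r\<close> is non-negative, then
  \<open>X\<^sub>1\<close> and the increments after time \<open>1\<close> are positively associated by Chebyshev's inequality in the
  single variable \<open>X\<^sub>1\<close>, so that a first step \<open>X\<^sub>1 \<le> u\<close> costs only a constant factor, which gives (3).
\<close>

text \<open>The Gaussian hypothesis concerns single linear combinations, while the regression needs
  joint independence; the Cramer-Wold device bridges the two. Slow variation compares
  \<open>l\<close> only at fixed ratios, so the walk is controlled along powers of two, where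
  \<open>sd\<close> eventually grows at each doubling by a factor of at least
  \<open>2 powr (H / 2)\<close>; this makes the chaining sums geometric. The two record counts reach
  different levels: the upper bound divides by the drop \<open>a\<close> and so needs a barrier
  strictly below 0, while the lower bound concerns the barrier 0. Joining them at a general level is
  the task of the extra hypotheses. The logarithms come from Gaussian tails: a cut-off at a multiple
  of \<open>sqrt (ln n)\<close> leaves an error that is a negative power of \<open>n\<close>, which
  \<open>sd n / n\<close> can absorb because \<open>sd\<close> is bounded away from 0. A translation
  of the first step has an unbounded density ratio, so it needs this cut-off and pays for it
  exponentially; the association inequality needs no cut-off and costs only a constant.\<close>

section \<open>The Cramer--Wold device\<close>

text \<open>The weight \<open>2 + \<psi>\<close> is positive, which turns the signed weight \<open>\<psi>\<close> into a probability density.\<close>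

lemma weighted_law_prob:
  fixes \<psi> Y :: "'a \<Rightarrow> real"
  assumes "prob_space M" and [measurable]: "\<psi> \<in> borel_measurable M" "Y \<in> borel_measurable M"
    and b: "\<And>x. \<bar>\<psi> x\<bar> \<le> 1" and m: "m = (LINT x|M. 2 + \<psi> x)"
  defines "P \<equiv> distr (density M (\<lambda>x. ennreal ((2 + \<psi> x) / m))) borel Y"
  shows "m \<ge> 1" "real_distribution P"
    "\<And>f :: real \<Rightarrow> real. (\<And>x. \<bar>f x\<bar> \<le> 1) \<Longrightarrow> f \<in> borel_measurable borel \<Longrightarrow>
      integral\<^sup>L P f = (2 * (LINT x|M. f (Y x)) + (LINT x|M. \<psi> x * f (Y x))) / m"
proof -
  interpret prob_space M by fact
  have pos: "1 \<le> 2 + \<psi> x" for x using b[of x] by linarith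
  have i\<psi>: "integrable M \<psi>"
    by (rule integrable_const_bound[of _ 1]) (use b in auto)
  have "(LINT x|M. 1) \<le> m" unfolding m
    by (rule integral_mono) (use pos i\<psi> in auto)
  then show m1: "m \<ge> 1" by (simp add: prob_space)
  have mm: "m = 2 + (LINT x|M. \<psi> x)" unfolding m using i\<psi> by (simp add: prob_space)
  have int1: "integral\<^sup>L P f = (LINT x|M. (2 + \<psi> x) / m * f (Y x))"
    if [measurable]: "f \<in> borel_measurable borel" for f :: "real \<Rightarrow> real"
  proof -
    have "integral\<^sup>L P f = integral\<^sup>L (density M (\<lambda>x. ennreal ((2 + \<psi> x) / m))) (\<lambda>x. f (Y x))"
      unfolding P_def by (rule integral_distr) auto
    also have "\<dots> = (LINT x|M. (2 + \<psi> x) / m * f (Y x))"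
      by (rule integral_real_density)
         (use m1 in \<open>auto intro!: AE_I2 divide_nonneg_nonneg order_trans[OF zero_le_one pos]\<close>)
    finally show ?thesis .
  qed
  have nn: "(\<integral>\<^sup>+x. ennreal ((2 + \<psi> x) / m) \<partial>M) = 1"
  proof -
    have "(\<integral>\<^sup>+x. ennreal ((2 + \<psi> x) / m) \<partial>M) = ennreal (LINT x|M. (2 + \<psi> x) / m)"
      by (rule nn_integral_eq_integral) (use i\<psi> pos m1 in \<open>auto intro!: divide_nonneg_nonneg order_trans[OF zero_le_one pos]\<close>)
    also have "(LINT x|M. (2 + \<psi> x) / m) = 1"
      using i\<psi> m1 mm by (simp add: prob_space)
    finally show ?thesis by simp
  qed
  have "prob_space (density M (\<lambda>x. ennreal ((2 + \<psi> x) / m)))"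
    by (rule prob_spaceI) (simp add: emeasure_density nn)
  then have "prob_space P" unfolding P_def by (rule prob_space.prob_space_distr) simp
  then show "real_distribution P"
    by (simp add: real_distribution_def real_distribution_axioms_def P_def)
  show "integral\<^sup>L P f = (2 * (LINT x|M. f (Y x)) + (LINT x|M. \<psi> x * f (Y x))) / m"
    if bf: "\<And>x. \<bar>f x\<bar> \<le> 1" and [measurable]: "f \<in> borel_measurable borel" for f :: "real \<Rightarrow> real"
  proof -
    have i1: "integrable M (\<lambda>x. f (Y x))"
      by (rule integrable_const_bound[of _ 1]) (use bf in auto)
    have i2: "integrable M (\<lambda>x. \<psi> x * f (Y x))"
      by (rule integrable_const_bound[of _ 1])
         (use bf b in \<open>auto simp: abs_mult intro!: mult_le_one\<close>)
    have "(LINT x|M. (2 + \<psi> x) / m * f (Y x)) = (LINT x|M. (2 * f (Y x) + \<psi> x * f (Y x)) / m)"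
      by (rule Bochner_Integration.integral_cong) (auto simp: field_simps)
    also have "\<dots> = (2 * (LINT x|M. f (Y x)) + (LINT x|M. \<psi> x * f (Y x))) / m"
      using i1 i2 by simp
    finally show ?thesis using int1[of f] by simp
  qed
qed

lemma real_distribution_char_Re_Im:
  assumes "real_distribution P"
  shows "Re (char P t) = (LINT x|P. cos (t * x))" "Im (char P t) = (LINT x|P. sin (t * x))"
proof -
  interpret real_distribution P by fact
  have i: "complex_integrable P (\<lambda>x. iexp (t * x))"
    by (rule integrable_const_bound[of _ 1]) (auto simp: norm_exp_i_times)
  have "Re (char P t) = (LINT x|P. Re (iexp (t * x)))"
    unfolding char_def using i by (rule integral_Re[symmetric])
  then show "Re (char P t) = (LINT x|P. cos (t * x))" by (simp add: Re_exp)
  have "Im (char P t) = (LINT x|P. Im (iexp (t * x)))"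
    unfolding char_def using i by (rule integral_Im[symmetric])
  then show "Im (char P t) = (LINT x|P. sin (t * x))" by (simp add: Im_exp)
qed

text \<open>The constant 2 in the weight contributes the unweighted law of \<open>Y\<close>, which
  \<open>law\<close> matches; the signed part is matched by \<open>eq\<close>. So the normalized
  laws have the same characteristic function, and after Levy uniqueness the constant part is
  subtracted again.\<close>

lemma weighted_law_eqI:
  fixes \<psi> Y :: "'a \<Rightarrow> real" and \<eta> Y' :: "'b \<Rightarrow> real"
  assumes M: "prob_space M" and N: "prob_space N"
    and [measurable]: "\<psi> \<in> borel_measurable M" "Y \<in> borel_measurable M"
    and [measurable]: "\<eta> \<in> borel_measurable N" "Y' \<in> borel_measurable N"
    and b: "\<And>x. \<bar>\<psi> x\<bar> \<le> 1" "\<And>x. \<bar>\<eta> x\<bar> \<le> 1"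
    and law: "distr M borel Y = distr N borel Y'"
    and eq: "\<And>\<phi> t. (LINT x|M. \<psi> x * cos (\<phi> + t * Y x)) = (LINT x|N. \<eta> x * cos (\<phi> + t * Y' x))"
    and [measurable]: "B \<in> sets borel"
  shows "(LINT x|M. \<psi> x * indicator B (Y x)) = (LINT x|N. \<eta> x * indicator B (Y' x))"
proof -
  define m where "m = (LINT x|M. 2 + \<psi> x)"
  define m' where "m' = (LINT x|N. 2 + \<eta> x)"
  define P where "P = distr (density M (\<lambda>x. ennreal ((2 + \<psi> x) / m))) borel Y"
  define Q where "Q = distr (density N (\<lambda>x. ennreal ((2 + \<eta> x) / m'))) borel Y'"
  interpret M: prob_space M by fact
  interpret N: prob_space N by fact
  have *: "integrable M \<psi>" "integrable N \<eta>"
    by (rule M.integrable_const_bound[of _ 1] N.integrable_const_bound[of _ 1]; use b in auto)+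
  \<comment> \<open>Phase and frequency 0 give the total masses of the weights.\<close>
  have mm': "m = m'" unfolding m_def m'_def using eq[of 0 0] * by (simp add: M.prob_space N.prob_space)
  note PP = weighted_law_prob[OF M _ _ b(1) m_def, of Y, folded P_def, simplified]
  note QQ = weighted_law_prob[OF N _ _ b(2) m'_def, of Y', folded Q_def, simplified]
  have same: "(LINT x|M. f (Y x)) = (LINT x|N. f (Y' x))" if [measurable]: "f \<in> borel_measurable borel" for f :: "real \<Rightarrow> real"
  proof -
    have "(LINT x|M. f (Y x)) = integral\<^sup>L (distr M borel Y) f" by (simp add: integral_distr)
    also have "\<dots> = (LINT x|N. f (Y' x))" unfolding law by (simp add: integral_distr)
    finally show ?thesis .
  qed
  have "char P = char Q"
  proof
    fix t
    have c: "integral\<^sup>L P (\<lambda>x. cos (\<phi> + t * x)) = integral\<^sup>L Q (\<lambda>x. cos (\<phi> + t * x))" for \<phi>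
      using PP(3)[of "\<lambda>x. cos (\<phi> + t * x)"] QQ(3)[of "\<lambda>x. cos (\<phi> + t * x)"]
        same[of "\<lambda>x. cos (\<phi> + t * x)"] eq[of \<phi> t] mm' by simp
    \<comment> \<open>The phase -\<pi>/2 supplies the imaginary part of the characteristic
      function.\<close>
    have s: "sin (t * x) = cos (- pi / 2 + t * x)" for x by (simp add: cos_diff)
    show "char P t = char Q t"
      using c[of 0] c[of "- pi / 2"]
      by (intro complex_eqI) (simp_all only: real_distribution_char_Re_Im[OF PP(2)] real_distribution_char_Re_Im[OF QQ(2)] s add_0)
  qed
  with PP(2) QQ(2) have "P = Q" by (rule Levy_uniqueness)
  then have "integral\<^sup>L P (indicator B) = integral\<^sup>L Q (indicator B :: real \<Rightarrow> real)" by simp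
  then show ?thesis
    using PP(1) mm'
      PP(3)[of "indicator B"] QQ(3)[of "indicator B"] same[of "indicator B"]
    by (simp add: indicator_abs_le_1)
qed

text \<open>The indicators replace the cosines one coordinate at a time: the product of the cosine of the
  remaining coordinates with the indicators chosen so far is the next weight. The phase \<open>\<phi>\<close> makes
  the hypothesis cover sines as well.\<close>

lemma weighted_joint_law_eqI:
  fixes \<psi> :: "'a \<Rightarrow> real" and \<eta> :: "'b \<Rightarrow> real" and Y :: "'i \<Rightarrow> 'a \<Rightarrow> real" and Y' :: "'i \<Rightarrow> 'b \<Rightarrow> real"
  assumes M: "prob_space M" and N: "prob_space N"
    and Y: "\<And>i. i \<in> I \<Longrightarrow> Y i \<in> borel_measurable M" "\<And>i. i \<in> I \<Longrightarrow> Y' i \<in> borel_measurable N"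
    and law: "\<And>i. i \<in> I \<Longrightarrow> distr M borel (Y i) = distr N borel (Y' i)"
    and B: "\<And>i. i \<in> I \<Longrightarrow> B i \<in> sets borel"
    and fin: "finite I"
    and "\<psi> \<in> borel_measurable M" "\<eta> \<in> borel_measurable N"
    and "\<And>x. \<bar>\<psi> x\<bar> \<le> 1" "\<And>x. \<bar>\<eta> x\<bar> \<le> 1"
    and "\<And>\<phi> c. (LINT x|M. \<psi> x * cos (\<phi> + (\<Sum>i\<in>I. c i * Y i x))) =
                (LINT x|N. \<eta> x * cos (\<phi> + (\<Sum>i\<in>I. c i * Y' i x)))"
  shows "(LINT x|M. \<psi> x * (\<Prod>i\<in>I. indicator (B i) (Y i x))) =
         (LINT x|N. \<eta> x * (\<Prod>i\<in>I. indicator (B i) (Y' i x)))"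
  using fin Y law B assms(8-)
proof (induction I arbitrary: \<psi> \<eta> rule: finite_induct)
  case empty
  show ?case using empty(9)[of 0 "\<lambda>_. 0"] by simp
next
  case (insert k I)
  interpret M: prob_space M by fact
  interpret N: prob_space N by fact
  have mY[measurable]: "Y k \<in> borel_measurable M" "Y' k \<in> borel_measurable N" using insert.prems by auto
  have sY[measurable]: "(\<lambda>x. \<Sum>i\<in>I. c i * Y i x) \<in> borel_measurable M"
       "(\<lambda>x. \<Sum>i\<in>I. c i * Y' i x) \<in> borel_measurable N" for c
    using insert.prems by (auto intro!: borel_measurable_sum)
  note [measurable] = insert.prems(5,6) insert.prems(4)[of k, simplified]
  note b = insert.prems(7,8)
  have bd: "\<bar>\<psi> x * cos a\<bar> \<le> 1" "\<bar>\<eta> y * cos a\<bar> \<le> 1" for x y a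
    using b by (auto simp: abs_mult intro!: mult_le_one)
  have eqk: "(LINT x|M. (\<psi> x * cos (\<phi> + (\<Sum>i\<in>I. c i * Y i x))) * indicator (B k) (Y k x)) =
        (LINT x|N. (\<eta> x * cos (\<phi> + (\<Sum>i\<in>I. c i * Y' i x))) * indicator (B k) (Y' k x))" for \<phi> c
  proof (rule weighted_law_eqI[OF M N])
    fix \<tau> t :: real
    \<comment> \<open>The product of two cosines is half the sum of the cosines of the sum and of
      the difference of the angles; \<open>cp\<close> and \<open>cm\<close> carry the coefficients
      \<open>t\<close> and \<open>- t\<close> of coordinate \<open>k\<close> in these two, so the
      hypothesis for \<open>insert k I\<close> applies to each.\<close>
    define cp where "cp = c(k := t)"
    define cm where "cm = c(k := - t)"
    have cpk: "(\<Sum>i\<in>insert k I. cp i * f i) = t * f k + (\<Sum>i\<in>I. c i * f i)"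
              "(\<Sum>i\<in>insert k I. cm i * f i) = - t * f k + (\<Sum>i\<in>I. c i * f i)" for f :: "'i \<Rightarrow> real"
      using insert.hyps by (auto simp: cp_def cm_def intro!: sum.cong)
    have e: "p * cos (\<phi> + (\<Sum>i\<in>I. c i * f i)) * cos (\<tau> + t * f k) =
        (p * cos ((\<phi> + \<tau>) + (\<Sum>i\<in>insert k I. cp i * f i)) + p * cos ((\<phi> - \<tau>) + (\<Sum>i\<in>insert k I. cm i * f i))) / 2"
      for p and f :: "'i \<Rightarrow> real"
      unfolding cpk mult.assoc cos_times_cos by (simp add: algebra_simps)
    have iM: "integrable M (\<lambda>x. \<psi> x * cos (a + (\<Sum>i\<in>insert k I. d i * Y i x)))" for a d
      by (rule M.integrable_const_bound[of _ 1]) (use bd insert.hyps in auto)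
    have iN: "integrable N (\<lambda>x. \<eta> x * cos (a + (\<Sum>i\<in>insert k I. d i * Y' i x)))" for a d
      by (rule N.integrable_const_bound[of _ 1]) (use bd insert.hyps in auto)
    show "(LINT x|M. \<psi> x * cos (\<phi> + (\<Sum>i\<in>I. c i * Y i x)) * cos (\<tau> + t * Y k x)) =
          (LINT x|N. \<eta> x * cos (\<phi> + (\<Sum>i\<in>I. c i * Y' i x)) * cos (\<tau> + t * Y' k x))"
      unfolding e[of "\<psi> _" "\<lambda>i. Y i _"] e[of "\<eta> _" "\<lambda>i. Y' i _"] using iM iN
      by (simp only: Bochner_Integration.integral_add integral_divide_zero insert.prems(9))
  qed (use bd insert.prems in auto)
  have "(LINT x|M. (\<psi> x * indicator (B k) (Y k x)) * (\<Prod>i\<in>I. indicator (B i) (Y i x))) =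
        (LINT x|N. (\<eta> x * indicator (B k) (Y' k x)) * (\<Prod>i\<in>I. indicator (B i) (Y' i x)))"
  \<comment> \<open>The indicator of coordinate \<open>k\<close> joins the weight, which stays
    bounded by 1.\<close>
  proof (rule insert.IH)
    fix \<phi> c
    show "(LINT x|M. \<psi> x * indicator (B k) (Y k x) * cos (\<phi> + (\<Sum>i\<in>I. c i * Y i x))) =
          (LINT x|N. \<eta> x * indicator (B k) (Y' k x) * cos (\<phi> + (\<Sum>i\<in>I. c i * Y' i x)))"
      using eqk[of \<phi> c] by (simp add: ac_simps)
  qed (use insert.prems b in \<open>auto simp: indicator_def\<close>)
  then show ?case using insert.hyps by (simp add: ac_simps)
qed

text \<open>The laws of linear combinations fix all cosine integrals; with the constant weight 1
  these yield the probabilities of rectangles, which generate the finite product space.\<close>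

lemma cramer_wold:
  fixes Y :: "'i \<Rightarrow> 'a \<Rightarrow> real" and Y' :: "'i \<Rightarrow> 'b \<Rightarrow> real"
  assumes M: "prob_space M" and N: "prob_space N" and fin: "finite I"
    and Y: "\<And>i. i \<in> I \<Longrightarrow> Y i \<in> borel_measurable M" "\<And>i. i \<in> I \<Longrightarrow> Y' i \<in> borel_measurable N"
    and law: "\<And>c. distr M borel (\<lambda>x. \<Sum>i\<in>I. c i * Y i x) = distr N borel (\<lambda>x. \<Sum>i\<in>I. c i * Y' i x)"
  shows "distr M (PiM I (\<lambda>_. borel)) (\<lambda>x. \<lambda>i\<in>I. Y i x) = distr N (PiM I (\<lambda>_. borel)) (\<lambda>x. \<lambda>i\<in>I. Y' i x)"
proof (rule measure_eqI_PiM_finite[OF fin])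
  interpret M: prob_space M by fact
  interpret N: prob_space N by fact
  note [measurable] = Y
  fix A :: "'i \<Rightarrow> real set"
  assume A: "A i \<in> sets borel" if "i \<in> I" for i
  have law1: "distr M borel (Y i) = distr N borel (Y' i)" if "i \<in> I" for i
    using law[of "\<lambda>j. if j = i then 1 else 0"] that fin by (simp add: if_distrib[of "\<lambda>x. x * _"] sum.If_cases cong: if_cong)
  have sY[measurable]: "(\<lambda>x. \<Sum>i\<in>I. c i * Y i x) \<in> borel_measurable M"
       "(\<lambda>x. \<Sum>i\<in>I. c i * Y' i x) \<in> borel_measurable N" for c
    by (auto intro!: borel_measurable_sum Y)
  have eq: "(LINT x|M. 1 * cos (\<phi> + (\<Sum>i\<in>I. c i * Y i x))) =
            (LINT x|N. 1 * cos (\<phi> + (\<Sum>i\<in>I. c i * Y' i x)))" for \<phi> c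
  proof -
    have "(LINT x|M. cos (\<phi> + (\<Sum>i\<in>I. c i * Y i x))) =
       integral\<^sup>L (distr M borel (\<lambda>x. \<Sum>i\<in>I. c i * Y i x)) (\<lambda>y. cos (\<phi> + y))"
      by (simp add: integral_distr)
    also have "\<dots> = (LINT x|N. cos (\<phi> + (\<Sum>i\<in>I. c i * Y' i x)))"
      unfolding law by (simp add: integral_distr)
    finally show ?thesis by simp
  qed
  have j: "(LINT x|M. 1 * (\<Prod>i\<in>I. indicator (A i) (Y i x))) =
         (LINT x|N. 1 * (\<Prod>i\<in>I. indicator (A i) (Y' i x) :: real))"
    by (rule weighted_joint_law_eqI[OF M N _ _ _ _ fin]) (use Y law1 A eq in auto)
  have prM: "(LINT x|M. (\<Prod>i\<in>I. indicator (A i) (Y i x) :: real)) = measure M {x\<in>space M. \<forall>i\<in>I. Y i x \<in> A i}"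
  proof -
    have "(LINT x|M. (\<Prod>i\<in>I. indicator (A i) (Y i x) :: real)) = (LINT x|M. indicator {x\<in>space M. \<forall>i\<in>I. Y i x \<in> A i} x)"
      by (rule Bochner_Integration.integral_cong) (use fin in \<open>auto simp: indicator_def\<close>)
    then show ?thesis by (auto intro!: arg_cong[of _ _ "measure M"])
  qed
  have prN: "(LINT x|N. (\<Prod>i\<in>I. indicator (A i) (Y' i x) :: real)) = measure N {x\<in>space N. \<forall>i\<in>I. Y' i x \<in> A i}"
  proof -
    have "(LINT x|N. (\<Prod>i\<in>I. indicator (A i) (Y' i x) :: real)) = (LINT x|N. indicator {x\<in>space N. \<forall>i\<in>I. Y' i x \<in> A i} x)"
      by (rule Bochner_Integration.integral_cong) (use fin in \<open>auto simp: indicator_def\<close>)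
    then show ?thesis by (auto intro!: arg_cong[of _ _ "measure N"])
  qed
  have S: "Pi\<^sub>E I A \<in> sets (PiM I (\<lambda>_. borel))" using fin A by auto
  have [measurable]: "(\<lambda>x. \<lambda>i\<in>I. Y i x) \<in> M \<rightarrow>\<^sub>M PiM I (\<lambda>_. borel)" "(\<lambda>x. \<lambda>i\<in>I. Y' i x) \<in> N \<rightarrow>\<^sub>M PiM I (\<lambda>_. borel)"
    by (auto intro!: measurable_restrict Y)
  have "emeasure (distr M (PiM I (\<lambda>_. borel)) (\<lambda>x. \<lambda>i\<in>I. Y i x)) (Pi\<^sub>E I A) = emeasure M {x\<in>space M. \<forall>i\<in>I. Y i x \<in> A i}"
    using S by (subst emeasure_distr) (auto intro!: arg_cong[of _ _ "emeasure M"] simp: PiE_iff)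
  also have "\<dots> = emeasure N {x\<in>space N. \<forall>i\<in>I. Y' i x \<in> A i}"
    using j prM prN by (simp add: M.emeasure_eq_measure N.emeasure_eq_measure)
  also have "\<dots> = emeasure (distr N (PiM I (\<lambda>_. borel)) (\<lambda>x. \<lambda>i\<in>I. Y' i x)) (Pi\<^sub>E I A)"
    using S by (subst emeasure_distr) (auto intro!: arg_cong[of _ _ "emeasure N"] simp: PiE_iff)
  finally show "emeasure (distr M (PiM I (\<lambda>_. borel)) (\<lambda>x. \<lambda>i\<in>I. Y i x)) (Pi\<^sub>E I A)
    = emeasure (distr N (PiM I (\<lambda>_. borel)) (\<lambda>x. \<lambda>i\<in>I. Y' i x)) (Pi\<^sub>E I A)" .
next
  interpret M: prob_space M by fact
  have [measurable]: "(\<lambda>x. \<lambda>i\<in>I. Y i x) \<in> M \<rightarrow>\<^sub>M PiM I (\<lambda>_. borel)"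
    by (auto intro!: measurable_restrict Y)
  interpret D: prob_space "distr M (PiM I (\<lambda>_. borel)) (\<lambda>x. \<lambda>i\<in>I. Y i x)"
    by (rule M.prob_space_distr) simp
  show "range (\<lambda>_::nat. Pi\<^sub>E I (\<lambda>_. UNIV)) \<subseteq> prod_algebra I (\<lambda>_. borel::real measure)"
    using fin by (auto intro!: prod_algebraI_finite)
  show "(\<Union>i::nat. Pi\<^sub>E I (\<lambda>_. UNIV)) = space (PiM I (\<lambda>_. borel::real measure))" by (simp add: space_PiM)
  show "emeasure (distr M (PiM I (\<lambda>_. borel)) (\<lambda>x. \<lambda>i\<in>I. Y i x)) (Pi\<^sub>E I (\<lambda>_. UNIV)) \<noteq> \<infinity>"
    using D.emeasure_finite by simp
qed auto

section \<open>Centered Gaussian sequences\<close>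

text \<open>The affine form includes the point mass at \<sigma> = 0, so degenerate combinations obey
  the same formulas as the others.\<close>

lemma normal_law_standard:
  assumes "0 \<le> \<sigma>"
  shows "normal_law \<mu> \<sigma> = distr std_normal_distribution borel (\<lambda>x. \<mu> + \<sigma> * x)"
proof (cases "\<sigma> = 0")
  case True
  interpret real_distribution std_normal_distribution by (rule real_dist_normal_dist)
  show ?thesis using True by (simp add: normal_law_def distr_const)
next
  case False
  interpret real_distribution std_normal_distribution by (rule real_dist_normal_dist)
  have "distributed std_normal_distribution lborel (\<lambda>x. x) (normal_density 0 1)"
    unfolding distributed_def by (auto simp: distr_id2[of lborel] intro!: distr_id2)
  from normal_density_affine[OF this, of \<sigma> \<mu>]
  have "distr std_normal_distribution lborel (\<lambda>x. \<mu> + \<sigma> * x) = density lborel (normal_density \<mu> \<sigma>)"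
    using False assms by (simp add: distributed_def)
  moreover have "distr std_normal_distribution lborel (\<lambda>x. \<mu> + \<sigma> * x) = distr std_normal_distribution borel (\<lambda>x. \<mu> + \<sigma> * x)"
    by (rule distr_cong) auto
  ultimately show ?thesis using False by (simp add: normal_law_def)
qed

section \<open>Moments and tails of the standard normal law\<close>

lemma std_normal_integrable_moment: "integrable std_normal_distribution (\<lambda>x. \<bar>x\<bar> ^ k)"
  using integrable_std_normal_moment_abs[of k] by (subst integrable_density) auto

lemma std_normal_mean: "(LINT x|std_normal_distribution. x) = 0"
  using integral_std_normal_distribution_moment_odd[of 1] by simp

lemma std_normal_variance: "(LINT x|std_normal_distribution. x\<^sup>2) = 1"
  using std_normal_distribution_even_moments[of 1] by (simp add: numeral_2_eq_2)

lemma std_normal_abs_mean: "(LINT x|std_normal_distribution. \<bar>x\<bar>) = sqrt (2 / pi)"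
  using std_normal_distribution_odd_moments_abs[of 0] by simp

text \<open>The constant of an exponential Markov inequality: \<open>exp (x\<^sup>2 / 4)\<close>
  uses up half of the Gaussian exponent and leaves a multiple of the density of variance 2. The
  factor 1 + |x| lets one estimate serve both tail probabilities and tails of the first absolute
  moment.\<close>

definition normal_tail_const :: real where
  "normal_tail_const = (LINT x|std_normal_distribution. (1 + \<bar>x\<bar>) * exp (x\<^sup>2 / 4))"

lemma normal_tail_integrable:
  "integrable std_normal_distribution (\<lambda>x. (1 + \<bar>x\<bar>) * exp (x\<^sup>2 / 4))"
proof -
  have d: "std_normal_density x * exp (x\<^sup>2 / 4) = sqrt 2 * normal_density 0 (sqrt 2) x" for x
  proof -
    have q: "sqrt (2 * pi * (sqrt 2)\<^sup>2) = sqrt (2 * pi) * sqrt 2" by (subst real_sqrt_mult[symmetric]) simp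
    have e: "exp (- x\<^sup>2 / 2) * exp (x\<^sup>2 / 4) = exp (- x\<^sup>2 / 4)" by (simp add: exp_add[symmetric])
    have "std_normal_density x * exp (x\<^sup>2 / 4) = 1 / sqrt (2 * pi) * (exp (- x\<^sup>2 / 2) * exp (x\<^sup>2 / 4))"
      by (simp add: std_normal_density_def)
    also have "\<dots> = sqrt 2 * (1 / (sqrt (2 * pi) * sqrt 2) * exp (- x\<^sup>2 / 4))" unfolding e by simp
    also have "\<dots> = sqrt 2 * normal_density 0 (sqrt 2) x"
      unfolding normal_density_def q by (simp del: real_sqrt_mult)
    finally show ?thesis .
  qed
  have e: "std_normal_density x * ((1 + \<bar>x\<bar>) * exp (x\<^sup>2 / 4)) =
      sqrt 2 * (normal_density 0 (sqrt 2) x + normal_density 0 (sqrt 2) x * \<bar>x\<bar>)" for x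
  proof -
    have "std_normal_density x * ((1 + \<bar>x\<bar>) * exp (x\<^sup>2 / 4)) = (std_normal_density x * exp (x\<^sup>2 / 4)) * (1 + \<bar>x\<bar>)"
      by simp
    then show ?thesis unfolding d by (simp add: algebra_simps)
  qed
  have "integrable lborel (\<lambda>x. std_normal_density x * ((1 + \<bar>x\<bar>) * exp (x\<^sup>2 / 4)))"
    unfolding e using integrable_normal_moment_abs[of "sqrt 2" 0 1] by simp
  then show ?thesis by (subst integrable_density) auto
qed

lemma normal_tail_const_ge_1: "normal_tail_const \<ge> 1"
proof -
  interpret real_distribution std_normal_distribution by (rule real_dist_normal_dist)
  have "(LINT x|std_normal_distribution. 1) \<le> normal_tail_const" unfolding normal_tail_const_def
  proof (rule integral_mono)
    show "1 \<le> (1 + \<bar>x\<bar>) * exp (x\<^sup>2 / 4)" for x :: real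
      using mult_mono[of 1 "1 + \<bar>x\<bar>" 1 "exp (x\<^sup>2/4)"] by simp
  qed (use normal_tail_integrable in auto)
  then show ?thesis using prob_space by simp
qed

lemma normal_tail:
  assumes "0 \<le> u"
  shows "(LINT x|std_normal_distribution. (1 + \<bar>x\<bar>) * indicator {x. u < \<bar>x\<bar>} x) \<le> normal_tail_const * exp (- u\<^sup>2 / 4)"
proof -
  have le: "(1 + \<bar>x\<bar>) * indicator {x. u < \<bar>x\<bar>} x \<le> (1 + \<bar>x\<bar>) * exp (x\<^sup>2 / 4) * exp (- u\<^sup>2 / 4)" for x :: real
  proof (cases "u < \<bar>x\<bar>")
    case True
    then have "u\<^sup>2 \<le> x\<^sup>2" using assms by (metis abs_le_square_iff abs_of_nonneg less_imp_le)
    then have "1 \<le> exp (x\<^sup>2 / 4) * exp (- u\<^sup>2 / 4)" by (simp add: exp_add[symmetric])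
    then have "(1 + \<bar>x\<bar>) * 1 \<le> (1 + \<bar>x\<bar>) * (exp (x\<^sup>2 / 4) * exp (- u\<^sup>2 / 4))" by (intro mult_left_mono) auto
    with True show ?thesis by (simp add: mult.assoc)
  qed auto
  have i: "integrable std_normal_distribution (\<lambda>x. (1 + \<bar>x\<bar>) * exp (x\<^sup>2 / 4) * exp (- u\<^sup>2 / 4))"
    using normal_tail_integrable by simp
  have "(LINT x|std_normal_distribution. (1 + \<bar>x\<bar>) * indicator {x. u < \<bar>x\<bar>} x) \<le>
        (LINT x|std_normal_distribution. (1 + \<bar>x\<bar>) * exp (x\<^sup>2 / 4) * exp (- u\<^sup>2 / 4))"
  proof (rule integral_mono[OF _ i le])
    show "integrable std_normal_distribution (\<lambda>x. (1 + \<bar>x\<bar>) * indicator {x. u < \<bar>x\<bar>} x)"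
      by (rule Bochner_Integration.integrable_bound[OF i]) (use le in \<open>auto intro!: AE_I2 simp: abs_mult\<close>)
  qed
  then show ?thesis by (simp add: normal_tail_const_def)
qed

text \<open>Stated as a scaled standard normal law, so that \<sigma> = 0 is allowed and every
  integral reduces to one against \<open>std_normal_distribution\<close>.\<close>

definition centered_normal :: "'a measure \<Rightarrow> ('a \<Rightarrow> real) \<Rightarrow> real \<Rightarrow> bool" where
  "centered_normal M S \<sigma> \<longleftrightarrow> S \<in> borel_measurable M \<and> 0 \<le> \<sigma> \<and>
     distr M borel S = distr std_normal_distribution borel (\<lambda>x. \<sigma> * x)"

lemma centered_normal_integral:
  assumes "centered_normal M S \<sigma>" and [measurable]: "f \<in> borel_measurable borel"
  shows "(LINT x|M. f (S x) :: real) = (LINT x|std_normal_distribution. f (\<sigma> * x))"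
proof -
  have [measurable]: "S \<in> borel_measurable M" using assms by (simp add: centered_normal_def)
  have "(LINT x|M. f (S x)) = integral\<^sup>L (distr M borel S) f" by (simp add: integral_distr)
  also have "\<dots> = (LINT x|std_normal_distribution. f (\<sigma> * x))"
    using assms by (simp add: integral_distr centered_normal_def)
  finally show ?thesis .
qed

lemma centered_normal_integrable:
  assumes "centered_normal M S \<sigma>" and [measurable]: "f \<in> borel_measurable borel"
    and "integrable std_normal_distribution (\<lambda>x. f (\<sigma> * x) :: real)"
  shows "integrable M (\<lambda>x. f (S x))"
proof -
  have [measurable]: "S \<in> borel_measurable M" using assms by (simp add: centered_normal_def)
  have "integrable (distr M borel S) f"
    using assms by (simp add: integrable_distr_eq centered_normal_def)
  then show ?thesis by (simp add: integrable_distr_eq)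
qed

lemma centered_normal_abs_power:
  assumes "centered_normal M S \<sigma>"
  shows "integrable M (\<lambda>x. \<bar>S x\<bar> ^ k)"
    "(LINT x|M. \<bar>S x\<bar> ^ k) = \<sigma> ^ k * (LINT x|std_normal_distribution. \<bar>x\<bar> ^ k)"
proof -
  have "0 \<le> \<sigma>" using assms by (simp add: centered_normal_def)
  then have e: "\<bar>\<sigma> * x\<bar> ^ k = \<sigma> ^ k * \<bar>x\<bar> ^ k" for x by (simp add: abs_mult power_mult_distrib)
  show "integrable M (\<lambda>x. \<bar>S x\<bar> ^ k)"
    by (rule centered_normal_integrable[OF assms, of "\<lambda>x. \<bar>x\<bar> ^ k"]) (auto simp: e std_normal_integrable_moment)
  show "(LINT x|M. \<bar>S x\<bar> ^ k) = \<sigma> ^ k * (LINT x|std_normal_distribution. \<bar>x\<bar> ^ k)"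
    by (subst centered_normal_integral[OF assms, of "\<lambda>x. \<bar>x\<bar> ^ k"]) (auto simp: e)
qed

lemma centered_normal_integrable_1:
  assumes "centered_normal M S \<sigma>"
  shows "integrable M S"
  using centered_normal_abs_power(1)[OF assms, of 1] assms
  by (simp add: integrable_abs_iff centered_normal_def)

lemma centered_normal_mean:
  assumes "centered_normal M S \<sigma>"
  shows "(LINT x|M. S x) = 0"
  using centered_normal_integral[OF assms, of "\<lambda>x. x"] by (simp add: std_normal_mean)

lemma centered_normal_square:
  assumes "centered_normal M S \<sigma>"
  shows "integrable M (\<lambda>x. (S x)\<^sup>2)" "(LINT x|M. (S x)\<^sup>2) = \<sigma>\<^sup>2"
  using centered_normal_abs_power[OF assms, of 2] by (simp_all add: std_normal_variance)

lemma centered_normal_abs_mean: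
  assumes "centered_normal M S \<sigma>"
  shows "(LINT x|M. \<bar>S x\<bar>) = \<sigma> * sqrt (2 / pi)"
  using centered_normal_abs_power(2)[OF assms, of 1] by (simp add: std_normal_abs_mean)

text \<open>The mean descent of the walk below its starting point; it forces records to exist in the
  lower bound.\<close>

lemma centered_normal_neg_part_mean:
  assumes "centered_normal M S \<sigma>"
  shows "integrable M (\<lambda>x. max 0 (- S x))" "(LINT x|M. max 0 (- S x)) = \<sigma> * sqrt (2 / pi) / 2"
proof -
  have e: "max 0 (- S x) = (\<bar>S x\<bar> - S x) / 2" for x by auto
  note i = centered_normal_integrable_1[OF assms]
  show "integrable M (\<lambda>x. max 0 (- S x))" unfolding e using i by simp
  show "(LINT x|M. max 0 (- S x)) = \<sigma> * sqrt (2 / pi) / 2"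
    unfolding e using i centered_normal_abs_mean[OF assms] centered_normal_mean[OF assms] by simp
qed

lemma centered_normal_tail:
  assumes "centered_normal M S 1" "0 \<le> u"
  shows "integrable M (\<lambda>x. (1 + \<bar>S x\<bar>) * indicator {x. u < \<bar>x\<bar>} (S x))"
    "(LINT x|M. (1 + \<bar>S x\<bar>) * indicator {x. u < \<bar>x\<bar>} (S x)) \<le> normal_tail_const * exp (- u\<^sup>2 / 4)"
proof -
  have [measurable]: "S \<in> borel_measurable M" using assms by (simp add: centered_normal_def)
  have "integrable std_normal_distribution (\<lambda>x. 1 + \<bar>x\<bar> ^ 1)"
    by (intro Bochner_Integration.integrable_add std_normal_integrable_moment)
       (use std_normal_integrable_moment[of 0] in simp)
  then have "integrable std_normal_distribution (\<lambda>x. (1 + \<bar>x\<bar>) * indicator {x. u < \<bar>x\<bar>} x)"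
    by (rule Bochner_Integration.integrable_bound) (auto simp: indicator_def)
  then show "integrable M (\<lambda>x. (1 + \<bar>S x\<bar>) * indicator {x. u < \<bar>x\<bar>} (S x))"
    by (intro centered_normal_integrable[OF assms(1), of "\<lambda>x. (1 + \<bar>x\<bar>) * indicator {x. u < \<bar>x\<bar>} x"]) auto
  show "(LINT x|M. (1 + \<bar>S x\<bar>) * indicator {x. u < \<bar>x\<bar>} (S x)) \<le> normal_tail_const * exp (- u\<^sup>2 / 4)"
    using normal_tail[OF assms(2)] centered_normal_integral[OF assms(1), of "\<lambda>x. (1 + \<bar>x\<bar>) * indicator {x. u < \<bar>x\<bar>} x"]
    by simp
qed

lemma centered_normal_char:
  assumes "centered_normal M S \<sigma>"
  shows "char (distr M borel S) t = complex_of_real (exp (- (\<sigma> * t)\<^sup>2 / 2))"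
proof -
  have "char (distr M borel S) t = char std_normal_distribution (\<sigma> * t)"
    using assms by (simp add: centered_normal_def char_def integral_distr mult_ac)
  then show ?thesis by (simp add: char_std_normal_distribution)
qed

section \<open>The linear span of a centered Gaussian sequence\<close>

locale centered_gaussian = prob_space M for M :: "'a measure" +
  fixes X :: "nat \<Rightarrow> 'a \<Rightarrow> real"
  assumes gaussian: "gaussian_sequence M X" and centered: "\<And>k. expectation (X k) = 0"
begin

definition lin :: "('a \<Rightarrow> real) \<Rightarrow> bool" where
  "lin S \<longleftrightarrow> (\<exists>n c. S = (\<lambda>\<omega>. \<Sum>i<n. c i * X i \<omega>))"

lemma linI: "S = (\<lambda>\<omega>. \<Sum>i<n. c i * X i \<omega>) \<Longrightarrow> lin S"
  unfolding lin_def by (intro exI)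

lemma X_measurable[measurable]: "X i \<in> borel_measurable M"
  using gaussian by (simp add: gaussian_sequence_def)

lemma lin_measurable: "lin S \<Longrightarrow> S \<in> borel_measurable M"
  unfolding lin_def by auto

lemma lin_X: "lin (X k)"
proof -
  have "X k = (\<lambda>\<omega>. \<Sum>i<Suc k. (if i = k then 1 else 0) * X i \<omega>)"
    by (auto simp: if_distrib[of "\<lambda>x. x * _"] cong: if_cong)
  then show ?thesis by (rule linI)
qed

lemma lin_zero: "lin (\<lambda>_. 0)"
  unfolding lin_def by (rule exI[of _ 0]) auto

lemma lin_scale:
  assumes "lin S" shows "lin (\<lambda>\<omega>. a * S \<omega>)"
proof -
  from assms obtain n c where "S = (\<lambda>\<omega>. \<Sum>i<n. c i * X i \<omega>)" by (auto simp: lin_def)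
  then have "(\<lambda>\<omega>. a * S \<omega>) = (\<lambda>\<omega>. \<Sum>i<n. (a * c i) * X i \<omega>)" by (auto simp: sum_distrib_left mult.assoc)
  then show ?thesis by (rule linI)
qed

lemma lin_add:
  assumes "lin S" "lin T" shows "lin (\<lambda>\<omega>. S \<omega> + T \<omega>)"
proof -
  from assms obtain n c m d where S: "S = (\<lambda>\<omega>. \<Sum>i<n. c i * X i \<omega>)" and T: "T = (\<lambda>\<omega>. \<Sum>i<m. d i * X i \<omega>)"
    by (auto simp: lin_def)
  define k where "k = max n m"
  have S': "S = (\<lambda>\<omega>. \<Sum>i<k. (if i < n then c i else 0) * X i \<omega>)" unfolding S
    by (rule ext, rule sum.mono_neutral_cong_left) (auto simp: k_def)
  have T': "T = (\<lambda>\<omega>. \<Sum>i<k. (if i < m then d i else 0) * X i \<omega>)" unfolding T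
    by (rule ext, rule sum.mono_neutral_cong_left) (auto simp: k_def)
  have "(\<lambda>\<omega>. S \<omega> + T \<omega>) = (\<lambda>\<omega>. \<Sum>i<k. ((if i < n then c i else 0) + (if i < m then d i else 0)) * X i \<omega>)"
    unfolding S' T' by (auto simp: sum.distrib[symmetric] distrib_right)
  then show ?thesis by (rule linI)
qed

lemma lin_diff: "lin S \<Longrightarrow> lin T \<Longrightarrow> lin (\<lambda>\<omega>. S \<omega> - T \<omega>)"
  using lin_add[OF _ lin_scale[of T "-1"], of S] by simp

lemma lin_sum: "(\<And>i. i \<in> I \<Longrightarrow> lin (S i)) \<Longrightarrow> lin (\<lambda>\<omega>. \<Sum>i\<in>I. S i \<omega>)"
  by (induction I rule: infinite_finite_induct) (auto intro: lin_add lin_zero)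

text \<open>\<open>gaussian_sequence\<close> leaves the parameters of the law unspecified;
  integrating the identity against it shows that \<mu> is the expectation.\<close>

lemma normal_ex:
  assumes "\<exists>\<mu> \<sigma>. 0 \<le> \<sigma> \<and> distr M borel S = normal_law \<mu> \<sigma>" and [measurable]: "S \<in> borel_measurable M"
  shows "\<exists>\<sigma>. 0 \<le> \<sigma> \<and> distr M borel S = distr std_normal_distribution borel (\<lambda>x. expectation S + \<sigma> * x) \<and> integrable M S"
proof -
  interpret N: real_distribution std_normal_distribution by (rule real_dist_normal_dist)
  from assms obtain \<mu> \<sigma> where s: "0 \<le> \<sigma>" and d: "distr M borel S = distr std_normal_distribution borel (\<lambda>x. \<mu> + \<sigma> * x)"
    by (auto simp: normal_law_standard)
  have i: "integrable std_normal_distribution (\<lambda>x. x)"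
    using integrable_std_normal_distribution_moment[of 1] by simp
  have i': "integrable std_normal_distribution (\<lambda>x. \<mu> + \<sigma> * x)"
    by (intro Bochner_Integration.integrable_add integrable_mult_right i N.integrable_const)
  have "expectation S = integral\<^sup>L (distr M borel S) (\<lambda>x. x)" by (simp add: integral_distr)
  also have "\<dots> = (LINT x|std_normal_distribution. \<mu> + \<sigma> * x)" unfolding d by (simp add: integral_distr)
  also have "\<dots> = \<mu>" using i by (simp add: std_normal_mean N.prob_space[simplified])
  finally have "expectation S = \<mu>" .
  moreover have "integrable M S"
  proof -
    have "integrable (distr M borel S) (\<lambda>x. x)" unfolding d
      using i' by (subst integrable_distr_eq) (simp_all only:, simp_all)
    then show ?thesis by (rule integrable_distr[rotated]) simp
  qed
  ultimately show ?thesis using s d by blast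
qed

lemma lin_law:
  assumes "lin S"
  shows "\<exists>\<mu> \<sigma>. 0 \<le> \<sigma> \<and> distr M borel S = normal_law \<mu> \<sigma>"
proof -
  from assms obtain n c where S: "S = (\<lambda>\<omega>. \<Sum>i<n. c i * X i \<omega>)" by (auto simp: lin_def)
  show ?thesis unfolding S using gaussian unfolding gaussian_sequence_def by blast
qed

lemma X_integrable: "integrable M (X k)"
  using normal_ex[OF lin_law[OF lin_X]] by auto

lemma lin_normal:
  assumes "lin S"
  shows "centered_normal M S (sqrt (expectation (\<lambda>\<omega>. (S \<omega>)\<^sup>2)))"
proof -
  from assms obtain n c where S: "S = (\<lambda>\<omega>. \<Sum>i<n. c i * X i \<omega>)" by (auto simp: lin_def)
  have ES: "expectation S = 0" unfolding S using X_integrable by (simp add: centered)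
  obtain \<sigma> where "0 \<le> \<sigma>" "distr M borel S = distr std_normal_distribution borel (\<lambda>x. \<sigma> * x)"
    using normal_ex[OF lin_law[OF assms]] lin_measurable[OF assms] ES by auto
  then have c: "centered_normal M S \<sigma>" using lin_measurable[OF assms] by (simp add: centered_normal_def)
  with centered_normal_square[OF c] show ?thesis by (simp add: centered_normal_def)
qed

lemma lin_integrable_mult:
  assumes "lin S" "lin T" shows "integrable M (\<lambda>\<omega>. S \<omega> * T \<omega>)"
proof -
  have [measurable]: "S \<in> borel_measurable M" "T \<in> borel_measurable M" using assms lin_measurable by auto
  have "integrable M (\<lambda>\<omega>. (S \<omega>)\<^sup>2 + (T \<omega>)\<^sup>2)"
    using centered_normal_square(1)[OF lin_normal] assms by auto
  then show ?thesis
  proof (rule Bochner_Integration.integrable_bound)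
    have "\<bar>S \<omega> * T \<omega>\<bar> \<le> (S \<omega>)\<^sup>2 + (T \<omega>)\<^sup>2" for \<omega>
      using sum_squares_bound[of "\<bar>S \<omega>\<bar>" "\<bar>T \<omega>\<bar>"] abs_ge_zero[of "S \<omega> * T \<omega>"]
      unfolding abs_mult power2_abs by linarith
    then show "AE \<omega> in M. norm (S \<omega> * T \<omega>) \<le> norm ((S \<omega>)\<^sup>2 + (T \<omega>)\<^sup>2)" by (auto intro!: AE_I2)
  qed simp
qed

end

section \<open>Gaussian regression\<close>

lemma char_sum_product:
  assumes "prob_space M" and [measurable]: "F \<in> borel_measurable M" "G \<in> borel_measurable M"
  shows "char (distr (M \<Otimes>\<^sub>M M) borel (\<lambda>z. F (fst z) + G (snd z))) t = char (distr M borel F) t * char (distr M borel G) t"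
proof -
  interpret prob_space M by fact
  interpret P: pair_prob_space M M ..
  have i: "complex_integrable (M \<Otimes>\<^sub>M M) (\<lambda>z. iexp (t * F (fst z)) * iexp (t * G (snd z)))"
    by (rule P.P.integrable_const_bound[of _ 1]) (auto simp: norm_mult norm_exp_i_times)
  have "char (distr (M \<Otimes>\<^sub>M M) borel (\<lambda>z. F (fst z) + G (snd z))) t =
      (CLINT z|(M \<Otimes>\<^sub>M M). iexp (t * F (fst z)) * iexp (t * G (snd z)))"
    by (simp add: char_def integral_distr exp_add[symmetric] ring_distribs)
  also have "\<dots> = (CLINT x|M. CLINT y|M. iexp (t * F x) * iexp (t * G y))"
    using P.integral_fst'[OF i] by simp
  also have "\<dots> = (CLINT x|M. iexp (t * F x)) * (CLINT y|M. iexp (t * G y))"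
    by simp
  finally show ?thesis by (simp add: char_def integral_distr)
qed

context centered_gaussian
begin

text \<open>The product space supplies independent copies. Without correlation the variances add,
  exactly as in the independent case, and a centered normal law is determined by its
  variance.\<close>

lemma uncorrelated_sum_law:
  assumes "lin Y" "lin T" and cov: "expectation (\<lambda>\<omega>. Y \<omega> * T \<omega>) = 0"
  shows "distr M borel (\<lambda>\<omega>. Y \<omega> + T \<omega>) = distr (M \<Otimes>\<^sub>M M) borel (\<lambda>z. Y (fst z) + T (snd z))"
proof -
  interpret P: pair_prob_space M M ..
  have [measurable]: "Y \<in> borel_measurable M" "T \<in> borel_measurable M" using assms lin_measurable by auto
  note YT = lin_add[OF assms(1,2)]
  define v where "v S = expectation (\<lambda>\<omega>. (S \<omega>)\<^sup>2)" for S :: "'a \<Rightarrow> real"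
  have v0: "0 \<le> v S" for S unfolding v_def by simp
  have "(Y \<omega> + T \<omega>)\<^sup>2 = (Y \<omega> * Y \<omega> + T \<omega> * T \<omega>) + 2 * (Y \<omega> * T \<omega>)" for \<omega>
    by (simp add: power2_eq_square algebra_simps)
  then have v: "v (\<lambda>\<omega>. Y \<omega> + T \<omega>) = v Y + v T"
    unfolding v_def using lin_integrable_mult assms by (simp add: power2_eq_square)
  have ch: "char (distr M borel S) t = complex_of_real (exp (- v S * t\<^sup>2 / 2))" if "lin S" for S t
    using centered_normal_char[OF lin_normal[OF that], of t] v0[of S]
    by (simp add: v_def[symmetric] power_mult_distrib)
  show ?thesis
  proof (rule Levy_uniqueness)
    show "real_distribution (distr M borel (\<lambda>\<omega>. Y \<omega> + T \<omega>))" by (rule real_distribution_distr) simp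
    show "real_distribution (distr (M \<Otimes>\<^sub>M M) borel (\<lambda>z. Y (fst z) + T (snd z)))"
      by (rule P.P.real_distribution_distr) simp
    show "char (distr M borel (\<lambda>\<omega>. Y \<omega> + T \<omega>)) = char (distr (M \<Otimes>\<^sub>M M) borel (\<lambda>z. Y (fst z) + T (snd z)))"
    proof
      fix t
      have "exp (- (v Y + v T) * t\<^sup>2 / 2) = exp (- v Y * t\<^sup>2 / 2) * exp (- v T * t\<^sup>2 / 2)"
        by (simp add: exp_add[symmetric] field_simps)
      then show "char (distr M borel (\<lambda>\<omega>. Y \<omega> + T \<omega>)) t = char (distr (M \<Otimes>\<^sub>M M) borel (\<lambda>z. Y (fst z) + T (snd z))) t"
        unfolding char_sum_product[OF prob_space_axioms \<open>Y \<in> borel_measurable M\<close> \<open>T \<in> borel_measurable M\<close>]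
          ch[OF YT] ch[OF assms(1)] ch[OF assms(2)] v
        by (simp only: of_real_mult)
    qed
  qed
qed

text \<open>The residuals \<open>U k - s k * Y\<close> are uncorrelated with \<open>Y\<close>, hence
  jointly independent of it by Cramer-Wold: on the product space \<open>Y\<close> may be read from
  the first component and the residuals from the second. Then \<open>g x\<close> is the conditional
  probability of the barrier event given \<open>Y\<close> = x.\<close>

lemma gaussian_regression:
  fixes U :: "'i \<Rightarrow> 'a \<Rightarrow> real" and b :: "'i \<Rightarrow> real"
  assumes Y: "lin Y" "expectation (\<lambda>\<omega>. (Y \<omega>)\<^sup>2) = 1" and fin: "finite I" and U: "\<And>k. k \<in> I \<Longrightarrow> lin (U k)"
    and A: "A \<in> sets borel"
    and s: "\<And>k. k \<in> I \<Longrightarrow> expectation (\<lambda>\<omega>. Y \<omega> * U k \<omega>) = s k"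
  defines "g \<equiv> \<lambda>x. prob {\<omega>\<in>space M. \<forall>k\<in>I. U k \<omega> - s k * Y \<omega> \<le> b k - s k * x}"
  shows "g \<in> borel_measurable borel"
    "prob {\<omega>\<in>space M. Y \<omega> \<in> A \<and> (\<forall>k\<in>I. U k \<omega> \<le> b k)} = (LINT x|std_normal_distribution. indicator A x * g x)"
proof -
  interpret P: pair_prob_space M M ..
  define V where "V k \<omega> = U k \<omega> - s k * Y \<omega>" for k \<omega>
  \<comment> \<open>\<open>None\<close> indexes \<open>Y\<close> and \<open>Some k\<close> the
    residual of \<open>U k\<close>, so that Cramer-Wold sees all variables as one vector.\<close>
  define J where "J = insert None (Some ` I)"
  define W where "W j = (case j of None \<Rightarrow> Y | Some k \<Rightarrow> V k)" for j
  define W' where "W' j = (case j of None \<Rightarrow> (\<lambda>z. Y (fst z)) | Some k \<Rightarrow> (\<lambda>z. V k (snd z)))" for j :: "'i option"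
  have linV: "lin (V k)" if "k \<in> I" for k
    unfolding V_def using lin_diff[OF U[OF that] lin_scale[OF Y(1)]] .
  have [measurable]: "Y \<in> borel_measurable M" using Y lin_measurable by auto
  have mV[measurable]: "V k \<in> borel_measurable M" if "k \<in> I" for k using linV[OF that] lin_measurable by auto
  note [measurable] = A
  have mW: "W j \<in> borel_measurable M" "W' j \<in> borel_measurable (M \<Otimes>\<^sub>M M)" if "j \<in> J" for j
    using that unfolding W_def W'_def J_def by (auto split: option.splits)
  have covV: "expectation (\<lambda>\<omega>. Y \<omega> * V k \<omega>) = 0" if "k \<in> I" for k
  proof -
    have "Y \<omega> * V k \<omega> = Y \<omega> * U k \<omega> - s k * (Y \<omega>)\<^sup>2" for \<omega>
      by (simp add: V_def algebra_simps power2_eq_square)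
    then show ?thesis
      using lin_integrable_mult[OF Y(1) U[OF that]] lin_integrable_mult[OF Y(1) Y(1)] Y(2) s[OF that]
      by (simp add: power2_eq_square)
  qed
  have law: "distr M (PiM J (\<lambda>_. borel)) (\<lambda>x. \<lambda>i\<in>J. W i x) = distr (M \<Otimes>\<^sub>M M) (PiM J (\<lambda>_. borel)) (\<lambda>x. \<lambda>i\<in>J. W' i x)"
  proof (rule cramer_wold[OF prob_space_axioms P.P.prob_space_axioms _ mW])
    show "finite J" using fin by (simp add: J_def)
    fix c :: "'i option \<Rightarrow> real"
    define T where "T \<omega> = (\<Sum>k\<in>I. c (Some k) * V k \<omega>)" for \<omega>
    have linT: "lin T" unfolding T_def by (intro lin_sum lin_scale linV)
    have sJ: "(\<Sum>j\<in>J. h j) = h None + (\<Sum>k\<in>I. h (Some k))" for h :: "'i option \<Rightarrow> real"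
      unfolding J_def using fin by (subst sum.insert) (auto simp: sum.reindex)
    \<comment> \<open>Every linear combination of the vector splits into a multiple of
      \<open>Y\<close> and an uncorrelated combination of residuals.\<close>
    have "c None * Y \<omega> * T \<omega> = (\<Sum>k\<in>I. c None * c (Some k) * (Y \<omega> * V k \<omega>))" for \<omega>
      by (simp add: T_def sum_distrib_left mult_ac)
    then have "expectation (\<lambda>\<omega>. c None * Y \<omega> * T \<omega>) =
        expectation (\<lambda>\<omega>. \<Sum>k\<in>I. c None * c (Some k) * (Y \<omega> * V k \<omega>))" by (simp only:)
    also have "\<dots> = (\<Sum>k\<in>I. expectation (\<lambda>\<omega>. c None * c (Some k) * (Y \<omega> * V k \<omega>)))"
      by (intro Bochner_Integration.integral_sum integrable_mult_right lin_integrable_mult Y linV)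
    also have "\<dots> = 0" using covV by (intro sum.neutral) simp
    finally have "expectation (\<lambda>\<omega>. c None * Y \<omega> * T \<omega>) = 0" .
    from uncorrelated_sum_law[OF lin_scale[OF Y(1)] linT this]
    show "distr M borel (\<lambda>x. \<Sum>i\<in>J. c i * W i x) = distr (M \<Otimes>\<^sub>M M) borel (\<lambda>x. \<Sum>i\<in>J. c i * W' i x)"
      unfolding sJ by (simp add: W_def W'_def T_def)
  qed
  \<comment> \<open>The event in residual coordinates, obtained by substituting
    \<open>U k = V k + s k * Y\<close>.\<close>
  define S where "S = {f \<in> space (PiM J (\<lambda>_. borel::real measure)). f None \<in> A \<and> (\<forall>k\<in>I. f (Some k) + s k * f None \<le> b k)}"
  have comp: "(\<lambda>f. f j) \<in> borel_measurable (PiM J (\<lambda>_. borel::real measure))" if "j \<in> J" for j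
    by (rule measurable_component_singleton[OF that])
  have Sm[measurable]: "S \<in> sets (PiM J (\<lambda>_. borel))"
  proof -
    have [measurable]: "(\<lambda>f. f None) \<in> borel_measurable (PiM J (\<lambda>_. borel::real measure))"
      by (rule comp) (simp add: J_def)
    have [measurable]: "(\<lambda>f. f (Some k)) \<in> borel_measurable (PiM J (\<lambda>_. borel::real measure))" if "k \<in> I" for k
      by (rule comp) (use that in \<open>simp add: J_def\<close>)
    show ?thesis unfolding S_def using fin by measurable
  qed
  have mr: "(\<lambda>x. \<lambda>i\<in>J. W i x) \<in> M \<rightarrow>\<^sub>M PiM J (\<lambda>_. borel)" "(\<lambda>x. \<lambda>i\<in>J. W' i x) \<in> M \<Otimes>\<^sub>M M \<rightarrow>\<^sub>M PiM J (\<lambda>_. borel)"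
    by (auto intro!: measurable_restrict mW)
  define Q where "Q x \<omega> \<longleftrightarrow> (\<forall>k\<in>I. V k \<omega> \<le> b k - s k * x)" for x \<omega>
  have "prob {\<omega>\<in>space M. Y \<omega> \<in> A \<and> (\<forall>k\<in>I. U k \<omega> \<le> b k)} = measure (distr M (PiM J (\<lambda>_. borel)) (\<lambda>x. \<lambda>i\<in>J. W i x)) S"
    unfolding measure_distr[OF mr(1) Sm]
    by (rule arg_cong[of _ _ prob]) (auto simp: S_def space_PiM J_def W_def V_def)
  also have "\<dots> = measure (M \<Otimes>\<^sub>M M) {z \<in> space (M \<Otimes>\<^sub>M M). Y (fst z) \<in> A \<and> Q (Y (fst z)) (snd z)}"
    unfolding law measure_distr[OF mr(2) Sm]
    by (rule arg_cong[of _ _ "measure (M \<Otimes>\<^sub>M M)"]) (auto simp: S_def space_PiM J_def W'_def Q_def algebra_simps)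
  also have "\<dots> = (LINT z|(M \<Otimes>\<^sub>M M). indicator {z \<in> space (M \<Otimes>\<^sub>M M). Y (fst z) \<in> A \<and> Q (Y (fst z)) (snd z)} z)"
    by (simp add: Int_absorb2)
  finally have 1: "prob {\<omega>\<in>space M. Y \<omega> \<in> A \<and> (\<forall>k\<in>I. U k \<omega> \<le> b k)} =
    (LINT z|(M \<Otimes>\<^sub>M M). indicator {z \<in> space (M \<Otimes>\<^sub>M M). Y (fst z) \<in> A \<and> Q (Y (fst z)) (snd z)} z)" .
  have mS: "{z \<in> space (M \<Otimes>\<^sub>M M). Y (fst z) \<in> A \<and> Q (Y (fst z)) (snd z)} \<in> sets (M \<Otimes>\<^sub>M M)"
    unfolding Q_def using fin by measurable
  have ii: "integrable (M \<Otimes>\<^sub>M M) (indicator {z \<in> space (M \<Otimes>\<^sub>M M). Y (fst z) \<in> A \<and> Q (Y (fst z)) (snd z)} :: _ \<Rightarrow> real)"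
    by (rule P.P.integrable_const_bound[of _ 1]) (use mS in auto)
  have g: "g x = (LINT \<omega>|M. indicator {\<omega>\<in>space M. Q x \<omega>} \<omega>)" for x
    unfolding g_def Q_def V_def by (simp add: Int_absorb2)
  have "(LINT z|(M \<Otimes>\<^sub>M M). indicator {z \<in> space (M \<Otimes>\<^sub>M M). Y (fst z) \<in> A \<and> Q (Y (fst z)) (snd z)} z :: real) =
    (LINT x|M. LINT y|M. indicator {z \<in> space (M \<Otimes>\<^sub>M M). Y (fst z) \<in> A \<and> Q (Y (fst z)) (snd z)} (x, y))"
    using P.integral_fst'[OF ii] by simp
  also have "\<dots> = (LINT x|M. indicator A (Y x) * g (Y x))"
  proof (rule Bochner_Integration.integral_cong)
    fix x assume x: "x \<in> space M"
    have "(LINT y|M. indicator {z \<in> space (M \<Otimes>\<^sub>M M). Y (fst z) \<in> A \<and> Q (Y (fst z)) (snd z)} (x, y) :: real) =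
          (LINT y|M. indicator A (Y x) * indicator {\<omega>\<in>space M. Q (Y x) \<omega>} y)"
      by (rule Bochner_Integration.integral_cong) (use x in \<open>auto simp: indicator_def space_pair_measure\<close>)
    then show "(LINT y|M. indicator {z \<in> space (M \<Otimes>\<^sub>M M). Y (fst z) \<in> A \<and> Q (Y (fst z)) (snd z)} (x, y) :: real) = indicator A (Y x) * g (Y x)"
      unfolding g by simp
  qed simp
  finally have 2: "(LINT z|(M \<Otimes>\<^sub>M M). indicator {z \<in> space (M \<Otimes>\<^sub>M M). Y (fst z) \<in> A \<and> Q (Y (fst z)) (snd z)} z :: real) = (LINT x|M. indicator A (Y x) * g (Y x))" .
  have mQ: "Measurable.pred (borel \<Otimes>\<^sub>M M) (\<lambda>z. Q (fst z) (snd z))"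
    unfolding Q_def using fin by measurable
  have "(\<lambda>x. LINT \<omega>|M. (if Q x \<omega> then 1 else 0 :: real)) \<in> borel_measurable borel"
    by (rule borel_measurable_lebesgue_integral) (use mQ in \<open>simp add: case_prod_beta'\<close>)
  moreover have "g = (\<lambda>x. LINT \<omega>|M. (if Q x \<omega> then 1 else 0 :: real))"
    unfolding g by (intro ext Bochner_Integration.integral_cong) (auto simp: indicator_def)
  ultimately show gm: "g \<in> borel_measurable borel" by simp
  have cn: "centered_normal M Y 1" using lin_normal[OF Y(1)] Y(2) by simp
  have "(LINT x|M. indicator A (Y x) * g (Y x)) = (LINT x|std_normal_distribution. indicator A x * g x)"
    using centered_normal_integral[OF cn, of "\<lambda>x. indicator A x * g x"] gm A by simp
  then show "prob {\<omega>\<in>space M. Y \<omega> \<in> A \<and> (\<forall>k\<in>I. U k \<omega> \<le> b k)} = (LINT x|std_normal_distribution. indicator A x * g x)"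
    using 1 2 by simp
qed

end

section \<open>Chaining and records of real sequences\<close>

text \<open>Growth by \<rho> is assumed only from index \<open>s\<close> on; the constant pays for
  the finitely many earlier steps, which the induction adds one by one from \<open>s\<close>
  downwards.\<close>

lemma geometric_growth:
  fixes d :: "nat \<Rightarrow> real"
  assumes pos: "\<And>j. d j > 0" and \<rho>: "\<rho> > 0" and ev: "\<And>j. j \<ge> s \<Longrightarrow> \<rho> * d j \<le> d (Suc j)"
  shows "\<exists>C\<ge>1. \<forall>j m. j \<le> m \<longrightarrow> \<rho> ^ (m - j) * d j \<le> C * d m"
proof -
  have "\<exists>C\<ge>1. \<forall>j m. s - k \<le> j \<longrightarrow> j \<le> m \<longrightarrow> \<rho> ^ (m - j) * d j \<le> C * d m" for k
  proof (induction k)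
    case 0
    have "\<rho> ^ i * d j \<le> d (j + i)" if "j \<ge> s" for i j
    proof (induction i)
      case (Suc i)
      have "\<rho> ^ Suc i * d j \<le> \<rho> * d (j + i)" using Suc \<rho> by (simp add: mult.assoc)
      also have "\<dots> \<le> d (j + Suc i)" using ev[of "j + i"] that by simp
      finally show ?case .
    qed simp
    from this[of _ "_ - _"] show ?case by (intro exI[of _ 1]) (metis diff_zero le_add_diff_inverse mult_1 order_refl)
  next
    case (Suc k)
    then obtain C where C: "C \<ge> 1" "\<And>j m. s - k \<le> j \<Longrightarrow> j \<le> m \<Longrightarrow> \<rho> ^ (m - j) * d j \<le> C * d m" by blast
    define t where "t = s - Suc k"
    \<comment> \<open>The quotient is the loss in the single new step from \<open>t\<close> to
      \<open>Suc t\<close>.\<close>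
    define C' where "C' = C * max 1 (\<rho> * d t / d (Suc t))"
    have CC': "C \<le> C'" unfolding C'_def using C(1) mult_left_mono[of 1 "max 1 (\<rho> * d t / d (Suc t))" C] by simp
    have "\<rho> ^ (m - j) * d j \<le> C' * d m" if "t \<le> j" "j \<le> m" for j m
    proof (cases "s - k \<le> j")
      case True
      then have "\<rho> ^ (m - j) * d j \<le> C * d m" using C that by simp
      also have "\<dots> \<le> C' * d m" using CC' pos[of m] by (simp add: mult_right_mono)
      finally show ?thesis .
    next
      case False
      then have j: "j = t" using that by (simp add: t_def)
      show ?thesis
      proof (cases "m = t")
        case True
        then show ?thesis using j CC' C(1) pos[of t] by simp
      next
        case False
        then have m: "Suc t \<le> m" using that j by simp
        have le: "s - k \<le> Suc t" by (simp add: t_def)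
        have "\<rho> ^ (m - t) * d t = (\<rho> * d t / d (Suc t)) * (\<rho> ^ (m - Suc t) * d (Suc t))"
        proof -
          have "m - t = Suc (m - Suc t)" using m by simp
          then show ?thesis using pos[of "Suc t"] by simp
        qed
        also have "\<dots> \<le> max 1 (\<rho> * d t / d (Suc t)) * (C * d m)"
        proof (rule mult_mono[OF _ C(2)[OF le m]])
          show "0 \<le> \<rho> ^ (m - Suc t) * d (Suc t)" using \<rho> pos[of "Suc t"] by simp
        qed auto
        finally show ?thesis unfolding C'_def j by (simp add: mult_ac)
      qed
    qed
    then show ?case using CC' C(1) unfolding t_def by (intro exI[of _ C']) auto
  qed
  from this[of s] show ?thesis by simp
qed

text \<open>Following the binary digits, \<open>k\<close> is reached from 0 by at most one dyadic
  step of each length \<open>2 ^ j\<close>, so one bound per scale is enough.\<close>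

lemma dyadic_chaining:
  fixes f :: "nat \<Rightarrow> real"
  assumes "f 0 = 0" "k \<le> 2 ^ m"
    and "\<And>j i. j \<le> m \<Longrightarrow> i < 2 ^ (m - j) \<Longrightarrow> \<bar>f (i * 2 ^ j + 2 ^ j) - f (i * 2 ^ j)\<bar> \<le> B j"
  shows "\<bar>f k\<bar> \<le> (\<Sum>j\<le>m. B j)"
  using assms
proof (induction m arbitrary: f k B)
  case 0
  have "0 \<le> B 0" "\<bar>f 1\<bar> \<le> B 0" using 0(3)[of 0 0] 0(1) by auto
  moreover have "k = 0 \<or> k = 1" using 0(2) by auto
  ultimately show ?case using 0(1) by auto
next
  case (Suc m)
  \<comment> \<open>Restriction to even indices removes the lowest digit and shifts every scale by
    one.\<close>
  define g where "g i = f (2 * i)" for i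
  define k' where "k' = k div 2"
  have "\<bar>g k'\<bar> \<le> (\<Sum>j\<le>m. B (Suc j))"
  proof (rule Suc.IH)
    show "g 0 = 0" using Suc.prems by (simp add: g_def)
    show "k' \<le> 2 ^ m" using Suc.prems by (auto simp: k'_def)
    fix j i assume "j \<le> m" "i < (2::nat) ^ (m - j)"
    then show "\<bar>g (i * 2 ^ j + 2 ^ j) - g (i * 2 ^ j)\<bar> \<le> B (Suc j)"
      using Suc.prems(3)[of "Suc j" i] by (simp add: g_def algebra_simps)
  qed
  moreover have "\<bar>f k - g k'\<bar> \<le> B 0"
  proof (cases "even k")
    case True
    have "0 \<le> B 0" using Suc.prems(3)[of 0 0] by (auto intro: order_trans[OF abs_ge_zero])
    then show ?thesis using True by (simp add: g_def k'_def)
  next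
    case False
    then have k: "k = 2 * k' + 1" by (simp add: k'_def)
    then have "2 * k' < 2 ^ Suc m" using Suc.prems(2) by linarith
    then show ?thesis using Suc.prems(3)[of 0 "2 * k'"] k by (simp add: g_def)
  qed
  moreover have "(\<Sum>j\<le>Suc m. B j) = B 0 + (\<Sum>j\<le>m. B (Suc j))" by (rule sum.atMost_Suc_shift)
  ultimately show ?case by linarith
qed

text \<open>With \<open>u\<close> as a threshold, this bounds the largest of many variables by
  \<open>u\<close> plus a sum of moments, whose expectation involves no joint law.\<close>

lemma abs_le_truncated_power:
  fixes x u :: real
  assumes "u > 0"
  shows "\<bar>x\<bar> \<le> u + \<bar>x\<bar> ^ Suc p / u ^ p"
proof (cases "\<bar>x\<bar> \<le> u")
  case True
  have "0 \<le> \<bar>x\<bar> ^ Suc p / u ^ p" using assms by simp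
  then show ?thesis using True by linarith
next
  case False
  have "\<bar>x\<bar> * u ^ p \<le> \<bar>x\<bar> ^ Suc p" using False assms by (simp add: mult_left_mono power_mono)
  then have "\<bar>x\<bar> \<le> \<bar>x\<bar> ^ Suc p / u ^ p" using assms by (simp add: pos_le_divide_eq)
  then show ?thesis using assms by linarith
qed

section \<open>Future maxima and record times\<close>

definition tail_max :: "(nat \<Rightarrow> real) \<Rightarrow> nat \<Rightarrow> nat \<Rightarrow> real" where
  "tail_max f T m = Max (f ` {m..T})"

lemma tail_max_step:
  assumes "m < T"
  shows "tail_max f T m = max (f m) (tail_max f T (Suc m))"
proof -
  have "{m..T} = insert m {Suc m..T}" using assms by auto
  then show ?thesis using assms by (simp add: tail_max_def)
qed

text \<open>By \<open>tail_max_step\<close>, the future maximum drops at time m by the excess of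
  \<open>f m\<close> over all later values; only times with such an excess contribute.\<close>

lemma tail_max_telescope:
  assumes "N \<le> T"
  shows "tail_max f T 0 - tail_max f T N = (\<Sum>m<N. max 0 (f m - tail_max f T (Suc m)))"
  using assms
proof (induction N)
  case (Suc N)
  then show ?case using tail_max_step[of N T f] by (auto simp: max_def)
qed simp

text \<open>A record looks \<open>n\<close> steps ahead and therefore sees everything up to the
  horizon \<open>n\<close>, so each one contributes at least \<open>a\<close> to the telescoping
  sum.\<close>

lemma sum_strict_drops:
  fixes f :: "nat \<Rightarrow> real"
  assumes "a \<ge> 0"
  shows "(\<Sum>m<n. a * (if \<forall>j\<in>{1..n}. f (m + j) \<le> f m - a then 1 else 0)) \<le> tail_max f n 0 - f n"
proof -
  have "(\<Sum>m<n. a * (if \<forall>j\<in>{1..n}. f (m + j) \<le> f m - a then 1 else 0)) \<le>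
        (\<Sum>m<n. max 0 (f m - tail_max f n (Suc m)))"
  proof (rule sum_mono)
    fix m assume m: "m \<in> {..<n}"
    have "tail_max f n (Suc m) \<le> f m - a" if r: "\<forall>j\<in>{1..n}. f (m + j) \<le> f m - a"
    proof -
      have "f i \<le> f m - a" if "i \<in> {Suc m..n}" for i
      proof -
        have "i - m \<in> {1..n}" "m + (i - m) = i" using that m by auto
        then show ?thesis using r by metis
      qed
      then show ?thesis unfolding tail_max_def using m by (subst Max_le_iff) auto
    qed
    then show "a * (if \<forall>j\<in>{1..n}. f (m + j) \<le> f m - a then 1 else 0) \<le> max 0 (f m - tail_max f n (Suc m))"
      by (auto simp: le_max_iff_disj)
  qed
  also have "\<dots> = tail_max f n 0 - f n"
    using tail_max_telescope[of n n f] by (simp add: tail_max_def)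
  finally show ?thesis .
qed

text \<open>The horizon N + n exceeds every m < N by at least n, so a time that contributes to the
  telescoping sum is a record. Its contribution is at most \<open>f m - f (Suc m)\<close>, because
  \<open>f (Suc m)\<close> is one of the later values.\<close>

lemma tail_max_le_records:
  fixes f :: "nat \<Rightarrow> real"
  assumes "n \<ge> 1"
  shows "tail_max f (N + n) 0 - tail_max f (N + n) N \<le>
    (\<Sum>m<N. \<bar>f (Suc m) - f m\<bar> * (if \<forall>j\<in>{1..n}. f (m + j) - f m < 0 then 1 else 0))"
proof -
  have "(\<Sum>m<N. max 0 (f m - tail_max f (N + n) (Suc m))) \<le>
    (\<Sum>m<N. \<bar>f (Suc m) - f m\<bar> * (if \<forall>j\<in>{1..n}. f (m + j) - f m < 0 then 1 else 0))"
  proof (rule sum_mono)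
    fix m assume m: "m \<in> {..<N}"
    define t where "t = tail_max f (N + n) (Suc m)"
    have le: "f i \<le> t" if "i \<in> {Suc m..N+n}" for i unfolding t_def tail_max_def using that by (intro Max_ge) auto
    show "max 0 (f m - t) \<le> \<bar>f (Suc m) - f m\<bar> * (if \<forall>j\<in>{1..n}. f (m + j) - f m < 0 then 1 else 0)"
    proof (cases "f m \<le> t")
      case True
      then show ?thesis by (simp add: max_def)
    next
      case False
      have "f (m + j) - f m < 0" if "j \<in> {1..n}" for j
        using le[of "m + j"] that m False by auto
      then have "\<forall>j\<in>{1..n}. f (m + j) - f m < 0" by blast
      moreover have "f (Suc m) \<le> t" using m assms by (intro le) auto
      ultimately show ?thesis using False by auto
    qed
  qed
  then show ?thesis using tail_max_telescope[of N "N + n" f] by simp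
qed

section \<open>Fluctuations of a Gaussian walk with stationary increments\<close>

locale gaussian_walk = centered_gaussian M X for M :: "'a measure" and X +
  assumes stationary: "stationary_sequence M X"
    and unit_variance: "\<And>k. expectation (\<lambda>\<omega>. (X k \<omega>)\<^sup>2) = 1"
begin

abbreviation Z :: "nat \<Rightarrow> 'a \<Rightarrow> real" where "Z \<equiv> partial_sum X"

definition sd :: "nat \<Rightarrow> real" where "sd n = sqrt (expectation (\<lambda>\<omega>. (Z n \<omega>)\<^sup>2))"

lemma lin_Z: "lin (Z n)"
  using lin_sum[of "{1..n}" X] lin_X by (simp add: partial_sum_def[abs_def])

lemma Z_measurable[measurable]: "Z n \<in> borel_measurable M"
  using lin_Z lin_measurable by auto

lemma Z_0: "Z 0 \<omega> = 0"
  by (simp add: partial_sum_def)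

lemma Z_Suc: "Z (Suc n) \<omega> = Z n \<omega> + X (Suc n) \<omega>"
  by (simp add: partial_sum_def)

lemma Z_shift: "Z (m + k) \<omega> - Z m \<omega> = (\<Sum>i=1..k. X (i + m) \<omega>)"
  by (induction k) (simp_all add: partial_sum_def add.commute[of m])

lemma X_normal: "centered_normal M (X k) 1"
  using lin_normal[OF lin_X[of k]] unit_variance[of k] by simp

lemma shift_law:
  "distr M (\<Pi>\<^sub>M i\<in>UNIV. borel) (\<lambda>\<omega> i. X (i + m) \<omega>) = distr M (\<Pi>\<^sub>M i\<in>UNIV. borel) (\<lambda>\<omega> i. X i \<omega>)"
  using stationary by (simp add: stationary_sequence_def)

lemma path_measurable: "(\<lambda>\<omega> i. X (i + m) \<omega>) \<in> M \<rightarrow>\<^sub>M (\<Pi>\<^sub>M i\<in>UNIV. borel)"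
  by (rule measurable_PiM_single') auto

lemma shift_expectation:
  assumes [measurable]: "F \<in> borel_measurable (\<Pi>\<^sub>M i\<in>(UNIV::nat set). borel :: real measure)"
  shows "expectation (\<lambda>\<omega>. F (\<lambda>i. X (i + m) \<omega>) :: real) = expectation (\<lambda>\<omega>. F (\<lambda>i. X i \<omega>))"
proof -
  have "expectation (\<lambda>\<omega>. F (\<lambda>i. X (i + m) \<omega>)) = integral\<^sup>L (distr M (\<Pi>\<^sub>M i\<in>UNIV. borel) (\<lambda>\<omega> i. X (i + m) \<omega>)) F"
    using path_measurable[of m] by (simp add: integral_distr)
  also have "\<dots> = expectation (\<lambda>\<omega>. F (\<lambda>i. X i \<omega>))"
    unfolding shift_law using path_measurable[of 0] by (simp add: integral_distr)
  finally show ?thesis .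
qed

lemma path_sum_measurable[measurable]:
  "(\<lambda>x. \<Sum>i=1..k. x i) \<in> borel_measurable (\<Pi>\<^sub>M i\<in>(UNIV::nat set). borel :: real measure)"
  by (intro borel_measurable_sum measurable_component_singleton) auto

text \<open>The increments after time m are the same functional of the shifted sequence as the walk
  is of the original one; this transfers stationarity to the walk.\<close>

lemma shift_prob_increments:
  assumes [measurable]: "B \<in> sets (\<Pi>\<^sub>M i\<in>(UNIV::nat set). borel :: real measure)"
  shows "prob {\<omega>\<in>space M. (\<lambda>k. Z (m + k) \<omega> - Z m \<omega>) \<in> B} = prob {\<omega>\<in>space M. (\<lambda>k. Z k \<omega>) \<in> B}"
proof -
  define F where "F x = (indicator B (\<lambda>k. \<Sum>i=1..k. x i) :: real)" for x :: "nat \<Rightarrow> real"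
  have [measurable]: "(\<lambda>x k. \<Sum>i=1..k. x i) \<in> (\<Pi>\<^sub>M i\<in>(UNIV::nat set). borel :: real measure) \<rightarrow>\<^sub>M (\<Pi>\<^sub>M i\<in>(UNIV::nat set). borel :: real measure)"
    by (rule measurable_PiM_single') auto
  have "F \<in> borel_measurable (\<Pi>\<^sub>M i\<in>(UNIV::nat set). borel :: real measure)"
    unfolding F_def by measurable
  from shift_expectation[OF this, of m]
  have e: "expectation (\<lambda>\<omega>. indicator B (\<lambda>k. Z (m + k) \<omega> - Z m \<omega>) :: real) = expectation (\<lambda>\<omega>. indicator B (\<lambda>k. Z k \<omega>))"
    unfolding F_def Z_shift by (simp add: partial_sum_def)
  have p: "prob {\<omega>\<in>space M. V \<omega> \<in> B} = expectation (\<lambda>\<omega>. indicator B (V \<omega>))" for V :: "'a \<Rightarrow> nat \<Rightarrow> real"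
  proof -
    have "expectation (\<lambda>\<omega>. indicator B (V \<omega>)) = expectation (\<lambda>\<omega>. indicator {\<omega>\<in>space M. V \<omega> \<in> B} \<omega> :: real)"
      by (rule Bochner_Integration.integral_cong) (auto simp: indicator_def)
    then show ?thesis by (simp add: Int_absorb2)
  qed
  show ?thesis unfolding p using e .
qed

lemma shift_prob:
  assumes "\<And>j. B j \<in> sets borel"
  shows "prob {\<omega>\<in>space M. \<forall>j\<in>{1..n}. Z (m + j) \<omega> - Z m \<omega> \<in> B j} = prob {\<omega>\<in>space M. \<forall>j\<in>{1..n}. Z j \<omega> \<in> B j}"
proof -
  note [measurable] = assms
  have "{x \<in> space (\<Pi>\<^sub>M i\<in>(UNIV::nat set). borel :: real measure). \<forall>j\<in>{1..n}. x j \<in> B j} \<in> sets (\<Pi>\<^sub>M i\<in>(UNIV::nat set). borel :: real measure)"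
    by measurable
  from shift_prob_increments[OF this, of m] show ?thesis by (simp add: space_PiM)
qed

lemma increment_normal: "centered_normal M (\<lambda>\<omega>. Z (m + k) \<omega> - Z m \<omega>) (sd k)"
proof -
  have "expectation (\<lambda>\<omega>. (Z (m + k) \<omega> - Z m \<omega>)\<^sup>2) = expectation (\<lambda>\<omega>. (Z k \<omega>)\<^sup>2)"
    using shift_expectation[of "\<lambda>x. (\<Sum>i=1..k. x i)\<^sup>2" m] unfolding Z_shift by (simp add: partial_sum_def)
  then show ?thesis using lin_normal[OF lin_diff[OF lin_Z[of "m + k"] lin_Z[of m]]] by (simp add: sd_def)
qed

lemma Z_normal: "centered_normal M (Z k) (sd k)"
  using increment_normal[of 0 k] by (simp add: Z_0)

lemma sd_nonneg: "0 \<le> sd n"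
  by (simp add: sd_def)

lemma sd_eq_abs_mean: "sd n = sqrt (pi / 2) * expectation (\<lambda>\<omega>. \<bar>Z n \<omega>\<bar>)"
  unfolding centered_normal_abs_mean[OF Z_normal] by (simp add: real_sqrt_divide)

text \<open>For centered normal variables the deviation is a fixed multiple of the mean absolute
  value, so the pointwise triangle inequality gives subadditivity; stationarity identifies the
  deviation of the second increment.\<close>

lemma sd_add: "sd (a + b) \<le> sd a + sd b"
proof -
  have i: "integrable M (\<lambda>\<omega>. \<bar>Z a \<omega>\<bar>)" "integrable M (\<lambda>\<omega>. \<bar>Z (a + b) \<omega> - Z a \<omega>\<bar>)" "integrable M (\<lambda>\<omega>. \<bar>Z (a + b) \<omega>\<bar>)"
    using centered_normal_integrable_1[OF Z_normal] centered_normal_integrable_1[OF increment_normal] by auto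
  have "expectation (\<lambda>\<omega>. \<bar>Z (a + b) \<omega>\<bar>) \<le> expectation (\<lambda>\<omega>. \<bar>Z a \<omega>\<bar> + \<bar>Z (a + b) \<omega> - Z a \<omega>\<bar>)"
    by (rule integral_mono) (use i in auto)
  also have "\<dots> = (sd a + sd b) * sqrt (2 / pi)"
    using i by (simp add: centered_normal_abs_mean[OF Z_normal] centered_normal_abs_mean[OF increment_normal] distrib_right)
  finally have "sd (a + b) * sqrt (2 / pi) \<le> (sd a + sd b) * sqrt (2 / pi)"
    by (simp add: centered_normal_abs_mean[OF Z_normal])
  then show ?thesis by simp
qed

lemma sd_0: "sd 0 = 0"
  by (simp add: sd_def Z_0)

lemma sd_1: "sd 1 = 1"
  using unit_variance[of 1] by (simp add: sd_def partial_sum_def)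

lemma sd_mult: "sd (q * n) \<le> real q * sd n"
proof (induction q)
  case (Suc q)
  have "sd (Suc q * n) \<le> sd n + sd (q * n)" using sd_add[of n "q * n"] by simp
  then show ?case using Suc by (simp add: algebra_simps)
qed (simp add: sd_0)

definition fluct :: "nat \<Rightarrow> nat \<Rightarrow> 'a \<Rightarrow> real" where
  "fluct m n \<omega> = Max ((\<lambda>k. \<bar>Z (m + k) \<omega> - Z m \<omega>\<bar>) ` {0..n})"

lemma fluct_ge: "k \<le> n \<Longrightarrow> \<bar>Z (m + k) \<omega> - Z m \<omega>\<bar> \<le> fluct m n \<omega>"
  unfolding fluct_def by (rule Max_ge) auto

lemma fluct_le: "(\<And>k. k \<le> n \<Longrightarrow> \<bar>Z (m + k) \<omega> - Z m \<omega>\<bar> \<le> B) \<Longrightarrow> fluct m n \<omega> \<le> B"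
  unfolding fluct_def by (subst Max_le_iff) auto

lemma fluct_nonneg: "0 \<le> fluct m n \<omega>"
  using fluct_ge[of 0 n m \<omega>] by simp

lemma fluct_measurable[measurable]: "fluct m n \<in> borel_measurable M"
  unfolding fluct_def[abs_def] by (rule borel_measurable_Max) auto

lemma fluct_integrable: "integrable M (fluct m n)"
proof -
  have "integrable M (\<lambda>\<omega>. \<Sum>k\<le>n. \<bar>Z (m + k) \<omega> - Z m \<omega>\<bar>)"
    using centered_normal_integrable_1[OF increment_normal] by auto
  then show ?thesis
  proof (rule Bochner_Integration.integrable_bound)
    have "fluct m n \<omega> \<le> (\<Sum>k\<le>n. \<bar>Z (m + k) \<omega> - Z m \<omega>\<bar>)" for \<omega>
      by (rule fluct_le) (auto intro!: member_le_sum)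
    then show "AE \<omega> in M. norm (fluct m n \<omega>) \<le> norm (\<Sum>k\<le>n. \<bar>Z (m + k) \<omega> - Z m \<omega>\<bar>)"
      using fluct_nonneg by (auto intro!: AE_I2 order_trans[OF _ abs_ge_self])
  qed simp
qed

end

text \<open>Isolates what the persistence bounds use of slow variation: geometric growth of
  \<open>sd\<close> along powers of two, up to the constant \<open>C0\<close>.\<close>

locale growing_gaussian_walk = gaussian_walk M X for M :: "'a measure" and X +
  fixes \<rho> C0 :: real
  assumes \<rho>: "1 < \<rho>" and C0: "C0 \<ge> 1"
    and growth: "\<And>j m. j \<le> m \<Longrightarrow> \<rho> ^ (m - j) * sd (2 ^ j) \<le> C0 * sd (2 ^ m)"
begin

lemma sd_dyadic_ge: "\<rho> ^ m \<le> C0 * sd (2 ^ m)"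
  using growth[of 0 m] sd_1 by simp

lemma sd_dyadic_pos: "0 < sd (2 ^ m)"
proof -
  have "0 < \<rho> ^ m" using \<rho> by simp
  then have "0 < C0 * sd (2 ^ m)" using sd_dyadic_ge[of m] by linarith
  then show ?thesis using C0 by (simp add: zero_less_mult_iff)
qed

text \<open>Chaining with the threshold \<open>\<theta> ^ (m - j) * sd (2 ^ j)\<close> at scale j.
  The excess over the threshold is controlled by a high moment, which outweighs the
  \<open>2 ^ (m - j)\<close> increments of that scale, and the thresholds themselves are summable
  against \<open>sd (2 ^ m)\<close>.\<close>

lemma fluct_dyadic:
  obtains C :: real where "C > 0" "\<And>m l. expectation (fluct l (2 ^ m)) \<le> C * sd (2 ^ m)"
proof -
  \<comment> \<open>Strictly between 1 and \<rho>: powers of \<theta> can outweigh the number of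
    increments, and the ratio \<theta>/\<rho> still gives a convergent geometric series.\<close>
  define \<theta> where "\<theta> = sqrt \<rho>"
  have \<theta>: "1 < \<theta>" "\<theta> < \<rho>" "0 < \<theta>"
    using \<rho> real_sqrt_less_mono[of \<rho> "\<rho>\<^sup>2"] by (auto simp: \<theta>_def power2_eq_square real_less_lsqrt)
  \<comment> \<open>Large enough for moments of order p + 1: the sum at scale j then carries the
    factor \<open>(2 / \<theta> ^ Suc p) ^ (m - j)\<close>, which is at most 1.\<close>
  obtain p where p: "2 \<le> \<theta> ^ p" using real_arch_pow[OF \<theta>(1), of 2] less_imp_le by blast
  then have p': "2 \<le> \<theta> ^ Suc p" using \<theta> mult_mono[of 1 \<theta> 2 "\<theta> ^ p"] by simp
  define \<mu> where "\<mu> = (LINT x|std_normal_distribution. \<bar>x\<bar> ^ Suc p)"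
  have \<mu>: "0 \<le> \<mu>" unfolding \<mu>_def by simp
  define C where "C = C0 * (1 + \<mu>) / (1 - \<theta> / \<rho>)"
  have q: "0 < \<theta> / \<rho>" "\<theta> / \<rho> < 1" using \<theta> \<rho> by auto
  have Cpos: "C > 0" unfolding C_def using q \<mu> C0 by (intro divide_pos_pos mult_pos_pos) auto
  have "expectation (fluct l (2 ^ m)) \<le> C * sd (2 ^ m)" for m l
  proof -
    define u where "u j = \<theta> ^ (m - j) * sd (2 ^ j)" for j
    have upos: "u j > 0" for j unfolding u_def using \<theta> sd_dyadic_pos by simp
    define inc where "inc j i \<omega> = Z ((l + i * 2 ^ j) + 2 ^ j) \<omega> - Z (l + i * 2 ^ j) \<omega>" for j i \<omega>
    define B where "B j \<omega> = u j + (\<Sum>i<2 ^ (m - j). \<bar>inc j i \<omega>\<bar> ^ Suc p) / u j ^ p" for j \<omega>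
    have cn: "centered_normal M (inc j i) (sd (2 ^ j))" for i j
      unfolding inc_def[abs_def] by (rule increment_normal)
    have iB: "integrable M (B j)" for j
      unfolding B_def[abs_def] using centered_normal_abs_power(1)[OF cn] by (intro Bochner_Integration.integrable_add integrable_const integrable_divide_zero Bochner_Integration.integrable_sum) (auto simp del: power_Suc)
    have "fluct l (2 ^ m) \<omega> \<le> (\<Sum>j\<le>m. B j \<omega>)" for \<omega>
    proof (rule fluct_le)
      fix k :: nat assume "k \<le> 2 ^ m"
      then show "\<bar>Z (l + k) \<omega> - Z l \<omega>\<bar> \<le> (\<Sum>j\<le>m. B j \<omega>)"
      proof (rule dyadic_chaining[of "\<lambda>k. Z (l + k) \<omega> - Z l \<omega>", rotated])
        fix j i :: nat assume ij: "j \<le> m" "i < 2 ^ (m - j)"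
        have "\<bar>inc j i \<omega>\<bar> \<le> u j + \<bar>inc j i \<omega>\<bar> ^ Suc p / u j ^ p" by (rule abs_le_truncated_power[OF upos])
        also have "\<dots> \<le> B j \<omega>" unfolding B_def
          using ij upos[of j] by (intro add_left_mono divide_right_mono member_le_sum) auto
        finally show "\<bar>Z (l + (i * 2 ^ j + 2 ^ j)) \<omega> - Z l \<omega> - (Z (l + i * 2 ^ j) \<omega> - Z l \<omega>)\<bar> \<le> B j \<omega>"
          by (simp add: inc_def add.assoc)
      qed simp
    qed
    then have "expectation (fluct l (2 ^ m)) \<le> expectation (\<lambda>\<omega>. \<Sum>j\<le>m. B j \<omega>)"
      using iB fluct_integrable by (intro integral_mono) auto
    also have "\<dots> = (\<Sum>j\<le>m. expectation (B j))" using iB by (intro Bochner_Integration.integral_sum) auto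
    also have "\<dots> \<le> (\<Sum>j\<le>m. C0 * (1 + \<mu>) * sd (2 ^ m) * (\<theta> / \<rho>) ^ (m - j))"
    proof (rule sum_mono)
      fix j assume "j \<in> {..m}"
      then have j: "j \<le> m" by simp
      have "expectation (B j) = u j + (2 ^ (m - j) * (sd (2 ^ j) ^ Suc p * \<mu>)) / u j ^ p"
        unfolding B_def[abs_def] using centered_normal_abs_power[OF cn, where k = "Suc p"]
        by (subst Bochner_Integration.integral_add)
           (auto simp: prob_space \<mu>_def Bochner_Integration.integral_sum
              simp del: power_Suc intro!: integrable_divide_zero Bochner_Integration.integrable_sum)
      also have "(2 ^ (m - j) * (sd (2 ^ j) ^ Suc p * \<mu>)) / u j ^ p = (2 / \<theta> ^ Suc p) ^ (m - j) * \<mu> * u j"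
      proof -
        have "sd (2 ^ j) \<noteq> 0" using sd_dyadic_pos[of j] by simp
        then show ?thesis unfolding u_def using \<theta>(3)
          by (simp add: power_mult_distrib power_divide field_simps power_mult[symmetric])
      qed
      also have "u j + (2 / \<theta> ^ Suc p) ^ (m - j) * \<mu> * u j \<le> u j + 1 * \<mu> * u j"
        using p' \<theta>(3) upos[of j] \<mu> by (intro add_left_mono mult_right_mono power_le_one) (auto simp: field_simps)
      also have "\<dots> = (1 + \<mu>) * \<theta> ^ (m - j) * sd (2 ^ j)" by (simp add: u_def algebra_simps)
      also have "\<dots> = (1 + \<mu>) * (\<theta> / \<rho>) ^ (m - j) * (\<rho> ^ (m - j) * sd (2 ^ j))"
        using \<rho> by (simp add: power_divide)
      also have "\<dots> \<le> (1 + \<mu>) * (\<theta> / \<rho>) ^ (m - j) * (C0 * sd (2 ^ m))"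
        using growth[OF j] \<mu> q by (intro mult_left_mono) auto
      finally show "expectation (B j) \<le> C0 * (1 + \<mu>) * sd (2 ^ m) * (\<theta> / \<rho>) ^ (m - j)"
        by (simp add: mult_ac)
    qed
    also have "\<dots> = C0 * (1 + \<mu>) * sd (2 ^ m) * (\<Sum>j\<le>m. (\<theta> / \<rho>) ^ (m - j))"
      by (simp add: sum_distrib_left)
    also have "(\<Sum>j\<le>m. (\<theta> / \<rho>) ^ (m - j)) = (\<Sum>j\<le>m. (\<theta> / \<rho>) ^ j)"
      by (rule sum.reindex_bij_witness[of _ "\<lambda>j. m - j" "\<lambda>j. m - j"]) auto
    also have "\<dots> = (1 - (\<theta> / \<rho>) ^ Suc m) / (1 - \<theta> / \<rho>)"
      using q \<theta>(2) sum_gp_strict[of "\<theta> / \<rho>" "Suc m"] unfolding lessThan_Suc_atMost by simp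
    also have "C0 * (1 + \<mu>) * sd (2 ^ m) * \<dots> \<le> C0 * (1 + \<mu>) * sd (2 ^ m) * (1 / (1 - \<theta> / \<rho>))"
      using q C0 \<mu> sd_nonneg by (intro mult_left_mono divide_right_mono) (auto simp del: power_Suc)
    finally show ?thesis by (simp add: C_def mult_ac)
  qed
  with Cpos that show ?thesis by blast
qed

lemma dyadic_bracket:
  assumes "n \<ge> (1::nat)" obtains m :: nat where "2 ^ m \<le> n" "n < 2 ^ Suc m"
  using ex_power_ivl1[of 2 n] assms by auto

lemma sd_dyadic_Suc: "sd (2 ^ Suc m) \<le> 2 * sd (2 ^ m)"
  using sd_mult[of 2 "2 ^ m"] by simp

lemma sd_le_fluct: "r \<le> n \<Longrightarrow> sd r \<le> sqrt (pi / 2) * expectation (fluct 0 n)"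
proof -
  assume "r \<le> n"
  then have "expectation (\<lambda>\<omega>. \<bar>Z r \<omega>\<bar>) \<le> expectation (fluct 0 n)"
    using fluct_ge[of r n 0] fluct_integrable[of 0 n] centered_normal_integrable_1[OF Z_normal[of r]]
    by (intro integral_mono) (auto simp: Z_0)
  then show ?thesis unfolding sd_eq_abs_mean by (rule mult_left_mono) simp
qed

text \<open>Between powers of two slow variation gives no direct control of \<open>sd\<close>. The lower bound comes from
  dividing \<open>2 ^ (m + L)\<close> by \<open>n\<close>: the remainder contributes at most a constant times \<open>sd (2 ^ m)\<close>, which
  \<open>sd (2 ^ (m + L))\<close> exceeds for large \<open>L\<close>.\<close>

lemma sd_comparable:
  obtains c C :: real where "c > 0" "C > 0" "\<And>m n. n \<le> 2 ^ Suc m \<Longrightarrow> sd n \<le> C * sd (2 ^ m)"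
    "\<And>m n. 2 ^ m \<le> n \<Longrightarrow> n < 2 ^ Suc m \<Longrightarrow> c * sd (2 ^ m) \<le> sd n"
proof -
  obtain C2 :: real where C2: "C2 > 0" "\<And>m l. expectation (fluct l (2 ^ m)) \<le> C2 * sd (2 ^ m)"
    using fluct_dyadic by blast
  define C where "C = sqrt (pi / 2) * C2 * 2"
  have C: "C > 0" unfolding C_def using C2 by simp
  have upper: "sd n \<le> C * sd (2 ^ m)" if "n \<le> 2 ^ Suc m" for m n
  proof -
    have "sd n \<le> sqrt (pi / 2) * expectation (fluct 0 (2 ^ Suc m))" by (rule sd_le_fluct[OF that])
    also have "\<dots> \<le> sqrt (pi / 2) * (C2 * (2 * sd (2 ^ m)))"
      using C2(2)[of 0 "Suc m"] sd_dyadic_Suc[of m] C2(1)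
      by (intro mult_left_mono order_trans[OF C2(2)]) auto
    finally show ?thesis by (simp add: C_def)
  qed
  \<comment> \<open>Then \<open>sd (2 ^ (m + L))\<close> is at least (C + 1) times
    \<open>sd (2 ^ m)\<close>, and one multiple survives after the remainder has taken C of
    them.\<close>
  obtain L where L: "C0 * (C + 1) < \<rho> ^ L" using real_arch_pow[OF \<rho>] by blast
  define c where "c = (1 / 2 ^ L :: real)"
  have lower: "c * sd (2 ^ m) \<le> sd n" if n: "2 ^ m \<le> n" "n < 2 ^ Suc m" for m n
  proof -
    define q where "q = 2 ^ (m + L) div n"
    define r where "r = 2 ^ (m + L) mod n"
    have npos: "n > 0" using n(1) by (metis gr0I less_le_trans not_less zero_less_numeral zero_less_power)
    have "2 ^ (m + L) = q * n + r" by (simp add: q_def r_def)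
    then have "sd (2 ^ (m + L)) \<le> real q * sd n + sd r"
      using sd_add[of "q * n" r] sd_mult[of q n] by simp
    also have "sd r \<le> C * sd (2 ^ m)"
      by (rule upper) (use n mod_less_divisor[OF npos, of "2 ^ (m + L)"] in \<open>unfold r_def, linarith\<close>)
    also have "q \<le> 2 ^ L"
    proof -
      have "q \<le> 2 ^ (m + L) div 2 ^ m" unfolding q_def by (rule div_le_mono2) (use n in auto)
      then show ?thesis by (simp add: power_add)
    qed
    then have "real q * sd n \<le> 2 ^ L * sd n"
      using sd_nonneg by (intro mult_right_mono) (simp_all add: of_nat_le_iff[symmetric] del: of_nat_le_iff)
    finally have 1: "sd (2 ^ (m + L)) \<le> 2 ^ L * sd n + C * sd (2 ^ m)" by simp
    have "C0 * ((C + 1) * sd (2 ^ m)) \<le> \<rho> ^ L * sd (2 ^ m)"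
      using L sd_nonneg[of "2 ^ m"] by (simp add: mult.assoc[symmetric] mult_right_mono)
    also have "\<dots> \<le> C0 * sd (2 ^ (m + L))" using growth[of m "m + L"] by simp
    finally have "(C + 1) * sd (2 ^ m) \<le> sd (2 ^ (m + L))" using C0 by simp
    then have "sd (2 ^ m) \<le> 2 ^ L * sd n" using 1 by (simp add: algebra_simps)
    then show ?thesis by (simp add: c_def field_simps)
  qed
  show ?thesis by (rule that[of c C]) (use C upper lower in \<open>auto simp: c_def\<close>)
qed

lemma fluct_bound:
  obtains C :: real where "C > 0" "\<And>n l. n \<ge> 1 \<Longrightarrow> expectation (fluct l n) \<le> C * sd n"
proof -
  obtain C2 :: real where C2: "C2 > 0" "\<And>m l. expectation (fluct l (2 ^ m)) \<le> C2 * sd (2 ^ m)"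
    using fluct_dyadic by blast
  obtain c C :: real where c: "c > 0" "C > 0" "\<And>m n. n \<le> 2 ^ Suc m \<Longrightarrow> sd n \<le> C * sd (2 ^ m)"
    "\<And>m n. 2 ^ m \<le> n \<Longrightarrow> n < 2 ^ Suc m \<Longrightarrow> c * sd (2 ^ m) \<le> sd n"
    using sd_comparable by blast
  have "expectation (fluct l n) \<le> (2 * C2 / c) * sd n" if n: "n \<ge> 1" for n l
  proof -
    obtain m where m: "2 ^ m \<le> n" "n < 2 ^ Suc m" using dyadic_bracket[OF n] .
    have "fluct l n \<omega> \<le> fluct l (2 ^ Suc m) \<omega>" for \<omega>
      by (rule fluct_le, rule fluct_ge) (use m in linarith)
    then have "expectation (fluct l n) \<le> expectation (fluct l (2 ^ Suc m))"
      using fluct_integrable by (intro integral_mono) auto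
    also have "\<dots> \<le> C2 * sd (2 ^ Suc m)" by (rule C2)
    also have "\<dots> \<le> C2 * (2 * sd (2 ^ m))" using sd_dyadic_Suc C2 by (intro mult_left_mono) auto
    also have "\<dots> \<le> C2 * (2 * (sd n / c))"
      using c(4)[OF m] c(1) C2 by (intro mult_left_mono) (auto simp: field_simps)
    finally show ?thesis by (simp add: mult_ac)
  qed
  then show ?thesis using that[of "2 * C2 / c"] C2 c by simp
qed

text \<open>Allows error terms that are powers of 1/n to be absorbed into the main term.\<close>

lemma sd_bounded_below:
  obtains c :: real where "c > 0" "\<And>n. n \<ge> 1 \<Longrightarrow> c \<le> sd n"
proof -
  obtain c C :: real where c: "c > 0" "C > 0" "\<And>m n. n \<le> 2 ^ Suc m \<Longrightarrow> sd n \<le> C * sd (2 ^ m)"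
    "\<And>m n. 2 ^ m \<le> n \<Longrightarrow> n < 2 ^ Suc m \<Longrightarrow> c * sd (2 ^ m) \<le> sd n"
    using sd_comparable by blast
  have "c / C0 \<le> sd n" if n: "n \<ge> 1" for n
  proof -
    obtain m where m: "2 ^ m \<le> n" "n < 2 ^ Suc m" using dyadic_bracket[OF n] .
    have "1 \<le> \<rho> ^ m" using \<rho> by simp
    then have "1 / C0 \<le> sd (2 ^ m)" using sd_dyadic_ge[of m] C0 by (simp add: field_simps)
    then have "c * (1 / C0) \<le> c * sd (2 ^ m)" using c by (intro mult_left_mono) auto
    also have "\<dots> \<le> sd n" by (rule c(4)[OF m])
    finally show ?thesis by simp
  qed
  then show ?thesis using that[of "c / C0"] c C0 by simp
qed

text \<open>The lower bound needs a time span on which the typical displacement dominates the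
  fluctuation over a window of length n. The span is a power of two times n, so that it moves the
  dyadic bracket by whole scales.\<close>

lemma sd_dilation:
  obtains K :: nat where "K \<ge> 1" "\<And>n. n \<ge> 1 \<Longrightarrow> R * sd n \<le> sd (K * n)"
proof -
  obtain c C :: real where c: "c > 0" "C > 0" "\<And>m n. n \<le> 2 ^ Suc m \<Longrightarrow> sd n \<le> C * sd (2 ^ m)"
    "\<And>m n. 2 ^ m \<le> n \<Longrightarrow> n < 2 ^ Suc m \<Longrightarrow> c * sd (2 ^ m) \<le> sd n"
    using sd_comparable by blast
  obtain k where k: "\<bar>R\<bar> * C * C0 / c < \<rho> ^ k" using real_arch_pow[OF \<rho>] by blast
  have "R * sd n \<le> sd (2 ^ k * n)" if n: "n \<ge> 1" for n
  proof -
    obtain m where m: "2 ^ m \<le> n" "n < 2 ^ Suc m" using dyadic_bracket[OF n] .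
    have b: "2 ^ (m + k) \<le> 2 ^ k * n" "2 ^ k * n < 2 ^ Suc (m + k)"
      using m by (simp_all add: power_add)
    have "R * sd n \<le> \<bar>R\<bar> * sd n" using sd_nonneg by (intro mult_right_mono) auto
    also have "\<dots> \<le> \<bar>R\<bar> * (C * sd (2 ^ m))" using c(3) m by (intro mult_left_mono) auto
    also have "\<dots> = c / C0 * ((\<bar>R\<bar> * C * C0 / c) * sd (2 ^ m))" using c C0 by simp
    also have "\<dots> \<le> c / C0 * (\<rho> ^ k * sd (2 ^ m))"
      using c C0 k sd_nonneg by (intro mult_left_mono mult_right_mono) auto
    also have "\<dots> \<le> c / C0 * (C0 * sd (2 ^ (m + k)))"
      using c C0 growth[of m "m + k"] by (intro mult_left_mono) auto
    also have "\<dots> \<le> sd (2 ^ k * n)" using c(4)[OF b] C0 by simp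
    finally show ?thesis .
  qed
  then show ?thesis using that[of "2 ^ k"] by simp
qed

end

section \<open>Moving the barrier\<close>

lemma std_normal_halfline_pos: "0 < measure std_normal_distribution {..u}"
proof (rule ccontr)
  interpret real_distribution std_normal_distribution by (rule real_dist_normal_dist)
  assume "\<not> 0 < measure std_normal_distribution {..u}"
  then have "emeasure std_normal_distribution {..u} = 0"
    using measure_nonneg[of std_normal_distribution "{..u}"] by (simp add: emeasure_eq_measure)
  then have "(\<integral>\<^sup>+x. ennreal (std_normal_density x) * indicator {..u} x \<partial>lborel) = 0"
    by (simp add: emeasure_density)
  then have "AE x in lborel. ennreal (std_normal_density x) * indicator {..u} x = 0"
    by (subst (asm) nn_integral_0_iff_AE) auto
  then have "AE x in lborel. x \<notin> {u - 1..u}"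
  proof (eventually_elim)
    case (elim x)
    have "std_normal_density x > 0" by (rule normal_density_pos) simp
    with elim show ?case by (auto simp: indicator_def split: if_splits)
  qed
  then have "emeasure lborel {u - 1..u} = 0"
    using AE_iff_null_sets[of "{u - 1..u}" lborel] by auto
  then show False by simp
qed

text \<open>A translation by t multiplies the density by
  \<open>exp (- t * x - t\<^sup>2 / 2)\<close>. Before the change of variable the argument is t + x;
  where it is at least -w, one has -x \<le> t + w and the factor is bounded, and the rest is a
  tail.\<close>

lemma std_normal_shift_bound:
  fixes g :: "real \<Rightarrow> real"
  assumes [measurable]: "g \<in> borel_measurable borel" and g: "\<And>x. 0 \<le> g x" "\<And>x. g x \<le> 1"
    and t: "0 \<le> t" and w: "0 \<le> w"
  shows "(LINT x|std_normal_distribution. g (x - t)) \<le>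
    exp (t * (t + w)) * (LINT x|std_normal_distribution. g x) + normal_tail_const * exp (- w\<^sup>2 / 4)"
proof -
  interpret N: real_distribution std_normal_distribution by (rule real_dist_normal_dist)
  define T where "T x = (1 + \<bar>x\<bar>) * indicator {x. w < \<bar>x\<bar>} x" for x :: real
  \<comment> \<open>Truncated on the left only, the side on which the density ratio is
    unbounded.\<close>
  define h where "h x = g (x - t) * indicator {- w..} x" for x
  have [measurable]: "h \<in> borel_measurable borel" unfolding h_def by measurable
  have [measurable]: "T \<in> borel_measurable borel" unfolding T_def by measurable
  have i1: "integrable std_normal_distribution (\<lambda>x. g (x - t))"
    by (rule N.integrable_const_bound[of _ 1]) (use g in auto)
  have i2: "integrable std_normal_distribution h"
    by (rule N.integrable_const_bound[of _ 1]) (use g in \<open>auto simp: h_def indicator_def\<close>)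
  have i3: "integrable std_normal_distribution T"
  proof (rule Bochner_Integration.integrable_bound)
    show "integrable std_normal_distribution (\<lambda>x. \<bar>x\<bar> ^ 0 + \<bar>x\<bar> ^ 1)"
      by (intro Bochner_Integration.integrable_add std_normal_integrable_moment)
  qed (auto simp: T_def indicator_def)
  have i4: "integrable std_normal_distribution g"
    by (rule N.integrable_const_bound[of _ 1]) (use g in auto)
  have "(LINT x|std_normal_distribution. g (x - t)) \<le> (LINT x|std_normal_distribution. h x + T x)"
  proof (rule integral_mono)
    fix x
    show "g (x - t) \<le> h x + T x"
      using g[of "x - t"] by (auto simp: h_def T_def indicator_def)
  qed (use i1 i2 i3 in auto)
  also have "\<dots> = (LINT x|std_normal_distribution. h x) + (LINT x|std_normal_distribution. T x)"
    using i2 i3 by simp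
  also have "(LINT x|std_normal_distribution. T x) \<le> normal_tail_const * exp (- w\<^sup>2 / 4)"
    using normal_tail[OF w] by (simp add: T_def)
  also have "(LINT x|std_normal_distribution. h x) = (LINT x|lborel. std_normal_density x * h x)"
    by (subst integral_real_density) auto
  also have "\<dots> = (LINT x|lborel. std_normal_density (t + x) * h (t + x))"
    using lborel_integral_real_affine[of 1 "\<lambda>x. std_normal_density x * h x" t] by simp
  also have "\<dots> \<le> (LINT x|lborel. exp (t * (t + w)) * (std_normal_density x * g x))"
  proof (rule integral_mono)
    have "integrable lborel (\<lambda>x. std_normal_density x * h x)"
      using i2 by (subst (asm) integrable_real_density) auto
    from lborel_integrable_real_affine[OF this, of 1 t]
    show "integrable lborel (\<lambda>x. std_normal_density (t + x) * h (t + x))" by simp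
    have "integrable lborel (\<lambda>x. std_normal_density x * g x)"
      using i4 by (subst (asm) integrable_real_density) auto
    then show "integrable lborel (\<lambda>x. exp (t * (t + w)) * (std_normal_density x * g x))" by simp
    fix x :: real
    show "std_normal_density (t + x) * h (t + x) \<le> exp (t * (t + w)) * (std_normal_density x * g x)"
    proof (cases "- w \<le> t + x")
      case True
      have "std_normal_density (t + x) = std_normal_density x * exp (- t * x - t\<^sup>2 / 2)"
        unfolding std_normal_density_def mult.assoc exp_add[symmetric]
        by (simp add: power2_eq_square field_simps)
      also have "\<dots> \<le> std_normal_density x * exp (t * (t + w))"
      proof -
        have "t * (- x) \<le> t * (t + w)" using True t by (intro mult_left_mono) auto
        then show ?thesis by (intro mult_left_mono) (auto intro: order_trans[OF _ \<open>t * (- x) \<le> _\<close>])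
      qed
      finally show ?thesis using True g(1)[of x] mult_right_mono[of _ _ "g x"]
        by (fastforce simp: h_def mult_ac)
    next
      case False
      then show ?thesis using g(1)[of x] by (simp add: h_def)
    qed
  qed
  also have "\<dots> = exp (t * (t + w)) * (LINT x|std_normal_distribution. g x)"
    by (subst integral_real_density) auto
  finally show ?thesis by simp
qed

text \<open>Both \<open>g x - g u\<close> and \<open>indicator {..u} x - p\<close> are non-negative
  for x \<le> u and non-positive beyond, so their product is non-negative; in its integral the terms
  with \<open>g u\<close> cancel.\<close>

lemma prob_chebyshev_antimono:
  fixes g :: "real \<Rightarrow> real"
  assumes "real_distribution N" and [measurable]: "g \<in> borel_measurable borel" and b: "\<And>x. \<bar>g x\<bar> \<le> 1"
    and "antimono g"
  shows "measure N {..u} * (LINT x|N. g x) \<le> (LINT x|N. indicator {..u} x * g x)"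
proof -
  interpret real_distribution N by fact
  define p where "p = measure N {..u}"
  have i: "integrable N g" "integrable N (\<lambda>x. indicator {..u} x * g x)"
    by (rule integrable_const_bound[of _ 1]; use b in \<open>auto simp: indicator_def intro: order_trans[OF abs_ge_zero b]\<close>)+
  have ii: "integrable N (indicator {..u} :: real \<Rightarrow> real)"
    by (rule integrable_const_bound[of _ 1]) auto
  have p: "(LINT x|N. indicator {..u} x) = p" "0 \<le> p" "p \<le> 1" by (auto simp: p_def)
  have "0 \<le> (LINT x|N. (g x - g u) * (indicator {..u} x - p))"
  proof (rule integral_nonneg_AE, rule AE_I2)
    fix x
    show "0 \<le> (g x - g u) * (indicator {..u} x - p)"
    proof (cases "x \<le> u")
      case True
      then have "g u \<le> g x" by (intro antimonoD[OF assms(4)])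
      then show ?thesis using True p(3) by (intro mult_nonneg_nonneg) auto
    next
      case False
      then have "g x \<le> g u" by (intro antimonoD[OF assms(4)]) simp
      then have "0 \<le> (g u - g x) * p" by (intro mult_nonneg_nonneg p(2)) linarith
      then show ?thesis using False by (simp add: algebra_simps)
    qed
  qed
  also have "(LINT x|N. (g x - g u) * (indicator {..u} x - p)) =
      (LINT x|N. (indicator {..u} x * g x - p * g x) - (g u * indicator {..u} x - g u * p))"
    by (rule Bochner_Integration.integral_cong) (auto simp: algebra_simps)
  also have "\<dots> = (LINT x|N. indicator {..u} x * g x) - p * (LINT x|N. g x)"
    using i ii p by (simp add: prob_space[simplified])
  finally show ?thesis by (simp add: p_def)
qed

context gaussian_walk
begin

text \<open>Quantified over the steps instead of using \<open>running_max\<close>, which is the form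
  of \<open>shift_prob\<close> and of the regression.\<close>

definition stay_le :: "real \<Rightarrow> nat \<Rightarrow> real" where
  "stay_le b n = prob {\<omega>\<in>space M. \<forall>j\<in>{1..n}. Z j \<omega> \<le> b}"

definition stay_neg :: "nat \<Rightarrow> real" where
  "stay_neg n = prob {\<omega>\<in>space M. \<forall>j\<in>{1..n}. Z j \<omega> < 0}"

lemma stay_neg_le: "0 \<le> b \<Longrightarrow> stay_neg n \<le> stay_le b n"
  unfolding stay_neg_def stay_le_def by (rule finite_measure_mono) (fastforce, measurable)

lemma Z_1: "Z (Suc 0) = X (Suc 0)"
  by (auto simp: partial_sum_def)

text \<open>After regression on \<open>X 1\<close>, lowering the first step by t lowers each
  \<open>Z k\<close> by at least \<open>\<kappa> * t\<close>, enough to cover the distance between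
  the barriers. The price is that of translating one standard normal variable.\<close>

lemma stay_le_drift:
  assumes \<kappa>: "0 < \<kappa>" "\<And>k. k \<ge> 1 \<Longrightarrow> \<kappa> \<le> expectation (\<lambda>\<omega>. X 1 \<omega> * Z k \<omega>)"
    and t: "0 \<le> t" "b - b' \<le> \<kappa> * t" and w: "0 \<le> w"
  shows "stay_le b n \<le> exp (t * (t + w)) * stay_le b' n + normal_tail_const * exp (- w\<^sup>2 / 4)"
proof -
  define s where "s k = expectation (\<lambda>\<omega>. X 1 \<omega> * Z k \<omega>)" for k
  define g where "g \<beta> x = prob {\<omega>\<in>space M. \<forall>k\<in>{1..n}. Z k \<omega> - s k * X 1 \<omega> \<le> \<beta> - s k * x}" for \<beta> x
  have m1: "lin (X 1)" "expectation (\<lambda>\<omega>. (X 1 \<omega>)\<^sup>2) = 1" by (rule lin_X unit_variance)+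
  note reg = gaussian_regression[of "X 1" "{1..n}" Z UNIV s, OF m1 finite_atLeastAtMost lin_Z _ s_def[symmetric]]
  have gm: "g \<beta> \<in> borel_measurable borel" for \<beta> unfolding g_def[abs_def]
    by (rule reg(1)) simp
  have gi: "stay_le \<beta> n = (LINT x|std_normal_distribution. g \<beta> x)" for \<beta>
    using reg(2)[of "\<lambda>_. \<beta>"] by (simp add: stay_le_def g_def[abs_def])
  \<comment> \<open>Replacing x by x - t raises the bound on the k-th residual by
    \<open>s k * t\<close>, which is at least b - b'.\<close>
  have mono: "g b x \<le> g b' (x - t)" for x
    unfolding g_def
  proof (rule finite_measure_mono)
    show "{\<omega> \<in> space M. \<forall>k\<in>{1..n}. Z k \<omega> - s k * X 1 \<omega> \<le> b - s k * x}
      \<subseteq> {\<omega> \<in> space M. \<forall>k\<in>{1..n}. Z k \<omega> - s k * X 1 \<omega> \<le> b' - s k * (x - t)}"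
    proof safe
      fix \<omega> k assume k: "k \<in> {1..n}" and "\<forall>k\<in>{1..n}. Z k \<omega> - s k * X 1 \<omega> \<le> b - s k * x"
      then have 1: "Z k \<omega> - s k * X 1 \<omega> \<le> b - s k * x" by blast
      have "\<kappa> * t \<le> s k * t" using \<kappa>(2)[of k] k t by (intro mult_right_mono) (auto simp: s_def)
      then show "Z k \<omega> - s k * X 1 \<omega> \<le> b' - s k * (x - t)" using 1 t by (simp add: algebra_simps)
    qed
  qed measurable
  interpret N: real_distribution std_normal_distribution by (rule real_dist_normal_dist)
  have [measurable]: "g \<beta> \<in> borel_measurable borel" for \<beta> by (rule gm)
  have "stay_le b n \<le> (LINT x|std_normal_distribution. g b' (x - t))"
    unfolding gi
    by (rule integral_mono[OF N.integrable_const_bound[of _ 1] N.integrable_const_bound[of _ 1] mono])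
       (auto simp: g_def)
  also have "\<dots> \<le> exp (t * (t + w)) * stay_le b' n + normal_tail_const * exp (- w\<^sup>2 / 4)"
    unfolding gi by (rule std_normal_shift_bound) (use t w in \<open>auto simp: g_def\<close>)
  finally show ?thesis .
qed

text \<open>With non-negative covariances, the conditional probability that the increments after
  time 1 stay below b decreases in the first step, so a low first step favours it. Both events
  together keep \<open>Z 1\<close> below u and all later values below u + b.\<close>

lemma stay_le_association:
  assumes nn: "\<And>k. 0 \<le> expectation (\<lambda>\<omega>. X 1 \<omega> * (Z (1 + k) \<omega> - Z 1 \<omega>))"
    and u: "u \<le> \<beta>" "u + b \<le> \<beta>"
  shows "measure std_normal_distribution {..u} * stay_le b n \<le> stay_le \<beta> n"
proof -
  define U where "U k \<omega> = Z (1 + k) \<omega> - Z 1 \<omega>" for k \<omega>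
  define s where "s k = expectation (\<lambda>\<omega>. X 1 \<omega> * U k \<omega>)" for k
  define g where "g x = prob {\<omega>\<in>space M. \<forall>k\<in>{1..n}. U k \<omega> - s k * X 1 \<omega> \<le> b - s k * x}" for x
  have linU: "lin (U k)" for k unfolding U_def[abs_def] by (rule lin_diff[OF lin_Z lin_Z])
  then have [measurable]: "U k \<in> borel_measurable M" for k by (rule lin_measurable)
  have m1: "lin (X 1)" "expectation (\<lambda>\<omega>. (X 1 \<omega>)\<^sup>2) = 1" by (rule lin_X unit_variance)+
  note reg = gaussian_regression[of "X 1" "{1..n}" U _ s "\<lambda>_. b", OF m1 finite_atLeastAtMost linU _ s_def[symmetric]]
  have gm: "g \<in> borel_measurable borel" unfolding g_def[abs_def] by (rule reg(1)) (rule sets.top)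
  have r: "prob {\<omega>\<in>space M. X 1 \<omega> \<in> A \<and> (\<forall>k\<in>{1..n}. U k \<omega> \<le> b)} = (LINT x|std_normal_distribution. indicator A x * g x)"
    if "A \<in> sets borel" for A unfolding g_def by (rule reg(2)) (use that in auto)
  have anti: "antimono g"
  proof (rule antimonoI)
    fix x y :: real assume xy: "x \<le> y"
    show "g y \<le> g x" unfolding g_def
    proof (rule finite_measure_mono)
      show "{\<omega> \<in> space M. \<forall>k\<in>{1..n}. U k \<omega> - s k * X 1 \<omega> \<le> b - s k * y}
        \<subseteq> {\<omega> \<in> space M. \<forall>k\<in>{1..n}. U k \<omega> - s k * X 1 \<omega> \<le> b - s k * x}"
      proof safe
        fix \<omega> k assume k: "k \<in> {1..n}" and "\<forall>k\<in>{1..n}. U k \<omega> - s k * X 1 \<omega> \<le> b - s k * y"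
        then have 1: "U k \<omega> - s k * X 1 \<omega> \<le> b - s k * y" by blast
        have "s k * x \<le> s k * y" using nn[of k] xy by (intro mult_left_mono) (auto simp: s_def U_def)
        then show "U k \<omega> - s k * X 1 \<omega> \<le> b - s k * x" using 1 by linarith
      qed
    qed measurable
  qed
  \<comment> \<open>By stationarity the walk restarted at time 1 stays below b with the same
    probability.\<close>
  have "stay_le b n = prob {\<omega>\<in>space M. \<forall>k\<in>{1..n}. U k \<omega> \<le> b}"
    using shift_prob[of "\<lambda>_. {..b}" n 1] by (simp add: stay_le_def U_def)
  also have "\<dots> = (LINT x|std_normal_distribution. g x)" using r[of UNIV] by simp
  finally have "measure std_normal_distribution {..u} * stay_le b n \<le> (LINT x|std_normal_distribution. indicator {..u} x * g x)"
    using prob_chebyshev_antimono[OF real_dist_normal_dist gm _ anti, of u] by (simp add: g_def)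
  also have "\<dots> = prob {\<omega>\<in>space M. X 1 \<omega> \<in> {..u} \<and> (\<forall>k\<in>{1..n}. U k \<omega> \<le> b)}" by (rule r[symmetric]) simp
  also have "\<dots> \<le> stay_le \<beta> n" unfolding stay_le_def
  proof (rule finite_measure_mono)
    show "{\<omega>\<in>space M. X 1 \<omega> \<in> {..u} \<and> (\<forall>k\<in>{1..n}. U k \<omega> \<le> b)} \<subseteq> {\<omega>\<in>space M. \<forall>j\<in>{1..n}. Z j \<omega> \<le> \<beta>}"
    proof safe
      fix \<omega> j assume j: "j \<in> {1..n}" and x: "X 1 \<omega> \<le> u" and a: "\<forall>k\<in>{1..n}. U k \<omega> \<le> b"
      show "Z j \<omega> \<le> \<beta>"
      proof (cases "j = 1")
        case True
        then show ?thesis using x u by (simp add: Z_1)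
      next
        case False
        then have "j - 1 \<in> {1..n}" using j by auto
        then have "U (j - 1) \<omega> \<le> b" using a by blast
        then show ?thesis using x u j by (simp add: U_def Z_1)
      qed
    qed
  qed measurable
  finally show ?thesis .
qed

end

section \<open>Persistence bounds\<close>

context growing_gaussian_walk
begin

text \<open>Among n times, records that each use up \<open>a\<close> of a range of mean order
  \<open>sd n\<close> have frequency at most of order \<open>sd n / n\<close>; the constant blows up
  as \<open>a\<close> tends to 0.\<close>

lemma stay_le_upper:
  assumes "a > 0"
  obtains c :: real where "c > 0" "\<And>n. n \<ge> 1 \<Longrightarrow> stay_le (- a) n \<le> c * (sd n / n)"
proof -
  obtain C :: real where C: "C > 0" "\<And>n l. n \<ge> 1 \<Longrightarrow> expectation (fluct l n) \<le> C * sd n"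
    using fluct_bound by blast
  have "stay_le (- a) n \<le> (2 * C / a) * (sd n / n)" if n: "n \<ge> 1" for n
  proof -
    define R where "R m = {\<omega>\<in>space M. \<forall>j\<in>{1..n}. Z (m + j) \<omega> - Z m \<omega> \<in> {..- a}}" for m
    have [measurable]: "R m \<in> events" for m unfolding R_def by measurable
    have indR: "integrable M (indicator (R m) :: _ \<Rightarrow> real)" for m
      by (rule integrable_const_bound[of _ 1]) auto
    have pR: "prob (R m) = stay_le (- a) n" for m
      using shift_prob[of "\<lambda>_. {..- a}" n m] by (simp add: R_def stay_le_def)
    have le: "(\<Sum>m<n. a * indicator (R m) \<omega>) \<le> 2 * fluct 0 n \<omega>" if \<omega>: "\<omega> \<in> space M" for \<omega>
    proof -
      have "(\<Sum>m<n. a * indicator (R m) \<omega>) = (\<Sum>m<n. a * (if \<forall>j\<in>{1..n}. Z (m + j) \<omega> \<le> Z m \<omega> - a then 1 else 0))"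
        using \<omega> by (intro sum.cong) (auto simp: R_def indicator_def algebra_simps)
      also have "\<dots> \<le> tail_max (\<lambda>k. Z k \<omega>) n 0 - Z n \<omega>"
        by (rule sum_strict_drops) (use assms in simp)
      also have "\<dots> \<le> 2 * fluct 0 n \<omega>"
      proof -
        have b: "\<bar>Z k \<omega>\<bar> \<le> fluct 0 n \<omega>" if "k \<le> n" for k
          using fluct_ge[OF that, of 0 \<omega>] by (simp add: Z_0)
        have "tail_max (\<lambda>k. Z k \<omega>) n 0 \<le> fluct 0 n \<omega>"
          unfolding tail_max_def by (subst Max_le_iff) (auto intro!: order_trans[OF abs_ge_self b])
        then show ?thesis using b[of n] by simp
      qed
      finally show ?thesis .
    qed
    have "real n * (a * stay_le (- a) n) = expectation (\<lambda>\<omega>. \<Sum>m<n. a * indicator (R m) \<omega>)"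
      using indR by (subst Bochner_Integration.integral_sum) (auto simp: pR)
    also have "\<dots> \<le> expectation (\<lambda>\<omega>. 2 * fluct 0 n \<omega>)"
    proof (rule integral_mono)
      show "integrable M (\<lambda>\<omega>. \<Sum>m<n. a * indicator (R m) \<omega>)"
        by (intro Bochner_Integration.integrable_sum integrable_mult_right indR)
    qed (use le fluct_integrable in auto)
    also have "\<dots> \<le> 2 * (C * sd n)" using C(2)[OF n, of 0] by simp
    finally show ?thesis using n assms by (simp add: field_simps)
  qed
  then show ?thesis using that[of "2 * C / a"] C(1) assms by simp
qed

text \<open>Each record is charged at most u, plus the part of the next step that exceeds u; the
  cut-off u stays free so that its choice can balance the two terms.\<close>

lemma sd_le_stay_neg:
  obtains K :: nat where "K \<ge> 1" "\<And>n u. n \<ge> 1 \<Longrightarrow> 0 \<le> u \<Longrightarrow>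
    sd n \<le> real (K * n) * (u * stay_neg n + normal_tail_const * exp (- u\<^sup>2 / 4))"
proof -
  obtain C :: real where C: "C > 0" "\<And>n l. n \<ge> 1 \<Longrightarrow> expectation (fluct l n) \<le> C * sd n"
    using fluct_bound by blast
  define \<gamma> where "\<gamma> = sqrt (2 / pi) / 2"
  have \<gamma>: "\<gamma> > 0" by (simp add: \<gamma>_def)
  \<comment> \<open>With this K, the mean descent \<open>\<gamma> * sd (K * n)\<close> pays for the
    fluctuation on the final window, at most \<open>C * sd n\<close>, and leaves
    \<open>sd n\<close>.\<close>
  obtain K :: nat where K: "K \<ge> 1" "\<And>n. n \<ge> 1 \<Longrightarrow> ((C + 1) / \<gamma>) * sd n \<le> sd (K * n)"
    using sd_dilation by blast
  have "sd n \<le> real (K * n) * (u * stay_neg n + normal_tail_const * exp (- u\<^sup>2 / 4))" if n: "n \<ge> 1" and u: "0 \<le> u" for n u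
  proof -
    define N where "N = K * n"
    define R where "R m = {\<omega>\<in>space M. \<forall>j\<in>{1..n}. Z (m + j) \<omega> - Z m \<omega> \<in> {..<0}}" for m
    have [measurable]: "R m \<in> events" for m unfolding R_def by measurable
    have indR: "integrable M (indicator (R m) :: _ \<Rightarrow> real)" for m
      by (rule integrable_const_bound[of _ 1]) auto
    have pR: "prob (R m) = stay_neg n" for m
      using shift_prob[of "\<lambda>_. {..<0}" n m] by (simp add: R_def stay_neg_def)
    define T where "T m \<omega> = (1 + \<bar>X (Suc m) \<omega>\<bar>) * indicator {x. u < \<bar>x\<bar>} (X (Suc m) \<omega>)" for m \<omega>
    have T: "integrable M (T m)" "expectation (T m) \<le> normal_tail_const * exp (- u\<^sup>2 / 4)" for m
      unfolding T_def[abs_def] using centered_normal_tail[OF X_normal u] by auto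
    \<comment> \<open>The future maximum is at least the larger of 0 and \<open>Z N\<close> at time
      0, and at most \<open>Z N + fluct N n\<close> at time N.\<close>
    have le: "max 0 (- Z N \<omega>) - fluct N n \<omega> \<le> (\<Sum>m<N. u * indicator (R m) \<omega> + T m \<omega>)" if \<omega>: "\<omega> \<in> space M" for \<omega>
    proof -
      define f where "f k = Z k \<omega>" for k
      have f0: "f 0 \<le> tail_max f (N + n) 0" "f N \<le> tail_max f (N + n) 0"
        unfolding tail_max_def by (auto intro!: Max_ge)
      have "f k \<le> f N + fluct N n \<omega>" if "k \<in> {N..N+n}" for k
      proof -
        from that obtain i where i: "k = N + i" "i \<le> n" by (metis atLeastAtMost_iff le_Suc_ex nat_add_left_cancel_le)
        then show ?thesis using fluct_ge[OF i(2), of N \<omega>] by (simp add: f_def)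
      qed
      then have "tail_max f (N + n) N \<le> f N + fluct N n \<omega>"
        unfolding tail_max_def by (subst Max_le_iff) auto
      then have "max 0 (- Z N \<omega>) - fluct N n \<omega> \<le> tail_max f (N + n) 0 - tail_max f (N + n) N"
        using f0 by (auto simp: f_def Z_0)
      also have "\<dots> \<le> (\<Sum>m<N. \<bar>f (Suc m) - f m\<bar> * (if \<forall>j\<in>{1..n}. f (m + j) - f m < 0 then 1 else 0))"
        by (rule tail_max_le_records[OF n])
      also have "\<dots> \<le> (\<Sum>m<N. u * indicator (R m) \<omega> + T m \<omega>)"
      proof (rule sum_mono)
        fix m
        have d: "f (Suc m) - f m = X (Suc m) \<omega>" by (simp add: f_def Z_Suc)
        have i: "(if \<forall>j\<in>{1..n}. f (m + j) - f m < 0 then 1 else 0) = (indicator (R m) \<omega> :: real)"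
          using \<omega> by (auto simp: f_def R_def indicator_def)
        show "\<bar>f (Suc m) - f m\<bar> * (if \<forall>j\<in>{1..n}. f (m + j) - f m < 0 then 1 else 0) \<le> u * indicator (R m) \<omega> + T m \<omega>"
          unfolding d i T_def using u by (auto simp: indicator_def)
      qed
      finally show ?thesis .
    qed
    have iR: "integrable M (\<lambda>\<omega>. u * indicator (R m) \<omega> + T m \<omega>)" for m
      using T(1) indR by (intro Bochner_Integration.integrable_add integrable_mult_right) auto
    note neg = centered_normal_neg_part_mean[OF Z_normal]
    have "(C + 1) * sd n - C * sd n \<le> \<gamma> * sd N - expectation (fluct N n)"
    proof -
      have "(C + 1) * sd n \<le> \<gamma> * sd N" using K(2)[OF n] \<gamma> by (simp add: N_def field_simps)
      then show ?thesis using C(2)[OF n, of N] by linarith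
    qed
    also have "\<dots> = expectation (\<lambda>\<omega>. max 0 (- Z N \<omega>) - fluct N n \<omega>)"
      using neg fluct_integrable by (simp add: \<gamma>_def)
    also have "\<dots> \<le> expectation (\<lambda>\<omega>. \<Sum>m<N. u * indicator (R m) \<omega> + T m \<omega>)"
      using le iR neg(1) fluct_integrable by (intro integral_mono) auto
    also have "\<dots> = (\<Sum>m<N. expectation (\<lambda>\<omega>. u * indicator (R m) \<omega> + T m \<omega>))"
      using iR by (intro Bochner_Integration.integral_sum) auto
    also have "\<dots> \<le> (\<Sum>m<N. u * stay_neg n + normal_tail_const * exp (- u\<^sup>2 / 4))"
    proof (rule sum_mono)
      fix m
      have "expectation (\<lambda>\<omega>. u * indicator (R m) \<omega> + T m \<omega>) = u * stay_neg n + expectation (T m)"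
        using T(1) indR by (subst Bochner_Integration.integral_add) (auto simp: pR)
      then show "expectation (\<lambda>\<omega>. u * indicator (R m) \<omega> + T m \<omega>) \<le> u * stay_neg n + normal_tail_const * exp (- u\<^sup>2 / 4)"
        using T(2)[of m] by simp
    qed
    finally show ?thesis by (simp add: N_def algebra_simps)
  qed
  then show ?thesis using that K(1) by blast
qed

lemma exp_log_tail:
  assumes "n \<ge> 1"
  shows "exp (- (2 * sqrt (real q * ln (real n)))\<^sup>2 / 4) = 1 / real n ^ q"
  using assms by (simp add: power_mult_distrib exp_minus exp_of_nat_mult inverse_eq_divide)

lemma power_2_ge:
  obtains q :: nat where "(B :: real) \<le> 2 ^ q"
  using real_arch_pow[of 2 B] less_imp_le by auto

lemma stay_neg_lower:
  obtains c :: real where "c > 0" "\<And>n. n \<ge> 2 \<Longrightarrow> 1 / c * (sd n / (n * sqrt (ln n))) \<le> stay_neg n"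
proof -
  obtain K :: nat where K: "K \<ge> 1" "\<And>n u. n \<ge> 1 \<Longrightarrow> 0 \<le> u \<Longrightarrow>
    sd n \<le> real (K * n) * (u * stay_neg n + normal_tail_const * exp (- u\<^sup>2 / 4))"
    using sd_le_stay_neg by blast
  obtain c0 :: real where c0: "c0 > 0" "\<And>n. n \<ge> 1 \<Longrightarrow> c0 \<le> sd n" using sd_bounded_below by blast
  \<comment> \<open>Fixed at the worst case n = 2: the tails then cost at most c0/2, half of the
    lower bound of \<open>sd n\<close>.\<close>
  obtain q :: nat where q: "2 * K * normal_tail_const / c0 \<le> 2 ^ q" using power_2_ge .
  define c where "c = 4 * K * sqrt (real (Suc q))"
  have "1 / c * (sd n / (n * sqrt (ln n))) \<le> stay_neg n" if n: "n \<ge> 2" for n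
  proof -
    \<comment> \<open>The exponent q + 1 instead of q, because one power of n is spent on the
      \<open>K * n\<close> summands.\<close>
    define u where "u = 2 * sqrt (real (Suc q) * ln (real n))"
    have ln: "ln (real n) > 0" using n by simp
    have u: "0 < u" unfolding u_def using ln by simp
    have "real (K * n) * (normal_tail_const * exp (- u\<^sup>2 / 4)) = K * normal_tail_const / real n ^ q"
      using exp_log_tail[of n "Suc q"] n by (simp add: u_def field_simps)
    also have "\<dots> \<le> K * normal_tail_const / 2 ^ q"
      using n normal_tail_const_ge_1 by (intro divide_left_mono power_mono mult_nonneg_nonneg) auto
    also have "\<dots> \<le> c0 / 2"
      using q c0(1) by (simp add: field_simps)
    also have "\<dots> \<le> sd n / 2" using c0(2)[of n] n by simp
    finally have "sd n / 2 \<le> real (K * n) * (u * stay_neg n)"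
      using K(2)[of n u] u n by (simp add: distrib_left)
    then have "sd n / (2 * real (K * n) * u) \<le> stay_neg n"
      using u K(1) n by (simp add: field_simps)
    also have "2 * real (K * n) * u = c * (n * sqrt (ln n))"
      unfolding u_def c_def by (simp add: real_sqrt_mult)
    finally show ?thesis by simp
  qed
  moreover have "c > 0" using K(1) by (simp add: c_def)
  ultimately show ?thesis using that by blast
qed

lemma stay_le_upper_drift:
  assumes \<kappa>: "0 < \<kappa>" "\<And>k. k \<ge> 1 \<Longrightarrow> \<kappa> \<le> expectation (\<lambda>\<omega>. X 1 \<omega> * Z k \<omega>)"
  obtains c :: real where "c > 0" "\<And>n. n \<ge> 1 \<Longrightarrow> stay_le b n \<le> sd n / n * exp (c * sqrt (ln n))"
proof -
  obtain C :: real where C: "C > 0" "\<And>n. n \<ge> 1 \<Longrightarrow> stay_le (- 1) n \<le> C * (sd n / n)"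
    using stay_le_upper[of 1] by auto
  obtain c0 :: real where c0: "c0 > 0" "\<And>n. n \<ge> 1 \<Longrightarrow> c0 \<le> sd n" using sd_bounded_below by blast
  define t where "t = max 0 ((b + 1) / \<kappa>)"
  have bt: "(b + 1) / \<kappa> \<le> t" by (simp add: t_def)
  have "0 \<le> t" by (simp add: t_def)
  then have t: "0 \<le> t" "b - (- 1) \<le> \<kappa> * t" using bt \<kappa>(1) by (simp_all add: pos_divide_le_eq mult.commute)
  define D where "D = exp (t\<^sup>2) * C + normal_tail_const / c0"
  have D: "D > 0" unfolding D_def using C(1) c0(1) normal_tail_const_ge_1 by (intro add_pos_pos) auto
  \<comment> \<open>The first term is the rate of the translation; the second absorbs the constant
    factor D into the exponential, since \<open>sqrt (ln n)\<close> is at least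
    \<open>sqrt (ln 2)\<close> for n \<ge> 2.\<close>
  define c where "c = 2 * t + D / sqrt (ln 2)"
  have "stay_le b n \<le> sd n / n * exp (c * sqrt (ln n))" if n: "n \<ge> 1" for n
  proof (cases "n = 1")
    \<comment> \<open>Here the exponential equals 1 and absorbs no constant, but the right-hand side
      is 1 because \<open>sd 1\<close> = 1.\<close>
    case True
    then show ?thesis using sd_1 by (simp add: stay_le_def)
  next
    case False
    then have n2: "n \<ge> 2" using n by simp
    define s where "s = sqrt (ln n)"
    have s: "sqrt (ln 2) \<le> s" "0 < sqrt (ln (2::real))" "0 \<le> s" using n2 by (auto simp: s_def)
    have sn: "0 \<le> sd n / n" using sd_nonneg by simp
    have "stay_le b n \<le> exp (t * (t + 2 * s)) * stay_le (- 1) n + normal_tail_const * exp (- (2 * s)\<^sup>2 / 4)"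
      by (rule stay_le_drift[OF \<kappa> t]) (use s in auto)
    also have "exp (- (2 * s)\<^sup>2 / 4) = 1 / n"
      using exp_log_tail[of n 1] n by (simp add: s_def)
    also have "exp (t * (t + 2 * s)) = exp (t\<^sup>2) * exp (2 * t * s)"
      by (simp add: exp_add[symmetric] power2_eq_square algebra_simps)
    also have "exp (t\<^sup>2) * exp (2 * t * s) * stay_le (- 1) n \<le> exp (t\<^sup>2) * exp (2 * t * s) * (C * (sd n / n))"
      using C(2)[OF n] by (intro mult_left_mono) auto
    also have "normal_tail_const * (1 / n) \<le> exp (2 * t * s) * (normal_tail_const / c0 * (sd n / n))"
    proof -
      have "normal_tail_const * (1 / n) \<le> 1 * (normal_tail_const / c0 * (sd n / n))"
        using c0(1) c0(2)[OF n] normal_tail_const_ge_1 n by (simp add: field_simps)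
      also have "\<dots> \<le> exp (2 * t * s) * (normal_tail_const / c0 * (sd n / n))"
        using t(1) s(3) sn c0(1) normal_tail_const_ge_1 by (intro mult_right_mono mult_nonneg_nonneg) auto
      finally show ?thesis .
    qed
    finally have "stay_le b n \<le> D * exp (2 * t * s) * (sd n / n)"
      by (simp add: D_def algebra_simps)
    also have "\<dots> \<le> exp (D / sqrt (ln 2) * s) * exp (2 * t * s) * (sd n / n)"
    proof (intro mult_right_mono)
      have "D \<le> exp D" using exp_ge_add_one_self[of D] by linarith
      also have "D * 1 \<le> D * (s / sqrt (ln 2))" using s D by (intro mult_left_mono) auto
      then have "exp D \<le> exp (D / sqrt (ln 2) * s)" by simp
      finally show "D \<le> exp (D / sqrt (ln 2) * s)" .
    qed (use sn in auto)
    also have "\<dots> = sd n / n * exp (c * s)"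
      by (simp add: c_def exp_add[symmetric] algebra_simps)
    finally show ?thesis by (simp add: s_def)
  qed
  moreover have "c > 0" unfolding c_def using D t by (intro add_nonneg_pos divide_pos_pos) auto
  ultimately show ?thesis using that by blast
qed

lemma stay_le_lower_drift:
  assumes \<kappa>: "0 < \<kappa>" "\<And>k. k \<ge> 1 \<Longrightarrow> \<kappa> \<le> expectation (\<lambda>\<omega>. X 1 \<omega> * Z k \<omega>)"
  obtains c :: real where "c > 0"
    "\<And>n. n \<ge> 2 \<Longrightarrow> 1 / c * (sd n / (n * sqrt (ln n))) * exp (- c * sqrt (ln n)) \<le> stay_le b n"
proof -
  obtain C :: real where C: "C > 0" "\<And>n. n \<ge> 2 \<Longrightarrow> 1 / C * (sd n / (n * sqrt (ln n))) \<le> stay_neg n"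
    using stay_neg_lower by blast
  obtain c0 :: real where c0: "c0 > 0" "\<And>n. n \<ge> 1 \<Longrightarrow> c0 \<le> sd n" using sd_bounded_below by blast
  define t where "t = max 0 (- b / \<kappa>)"
  have "- b / \<kappa> \<le> t" by (simp add: t_def)
  then have "- b \<le> t * \<kappa>" using \<kappa>(1) by (simp only: pos_divide_le_eq)
  then have t: "0 \<le> t" "0 - b \<le> \<kappa> * t" by (simp_all add: t_def mult.commute)
  \<comment> \<open>The tail is to cost at most half of the main term. Of the decay
    \<open>1 / n ^ (q + 2)\<close>, the power q beats the constants and the remaining two powers
    beat \<open>1 / (n * s)\<close>, as s \<le> n.\<close>
  obtain q :: nat where q: "2 * C * normal_tail_const / c0 \<le> 2 ^ q" using power_2_ge .
  define A where "A = 2 * sqrt (real (q + 2))"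
  \<comment> \<open>One constant for two uses: it dominates both the denominator and the exponential
    rate.\<close>
  define c where "c = 2 * C * exp (t\<^sup>2) + t * A"
  have A: "A > 0" by (simp add: A_def)
  have cpos: "c > 0" unfolding c_def using C(1) t(1) A by (intro add_pos_nonneg) auto
  have "1 / c * (sd n / (n * sqrt (ln n))) * exp (- c * sqrt (ln n)) \<le> stay_le b n" if n: "n \<ge> 2" for n
  proof -
    define s where "s = sqrt (ln n)"
    define x where "x = sd n / (n * s)"
    have ln: "0 < ln (real n)" using n by simp
    then have s: "0 < s" by (simp add: s_def)
    have "ln (real n) \<le> (real n)\<^sup>2"
    proof -
      have "1 * real n \<le> real n * real n" using n by (intro mult_right_mono) auto
      moreover have "ln (real n) \<le> real n - 1" using n by (intro ln_le_minus_one) simp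
      ultimately show ?thesis unfolding power2_eq_square by linarith
    qed
    then have sn: "s \<le> n" unfolding s_def using real_sqrt_le_mono[of "ln (real n)" "(real n)\<^sup>2"] by simp
    have x: "0 \<le> x" unfolding x_def using sd_nonneg s by simp
    have "1 / C * x \<le> stay_le 0 n"
      using C(2)[OF n] stay_neg_le[of 0 n] by (simp add: x_def s_def)
    also have "\<dots> \<le> exp (t * (t + A * s)) * stay_le b n + normal_tail_const * exp (- (A * s)\<^sup>2 / 4)"
      by (rule stay_le_drift[OF \<kappa> t]) (use s A in auto)
    also have "normal_tail_const * exp (- (A * s)\<^sup>2 / 4) \<le> 1 / (2 * C) * x"
    proof -
      have "exp (- (A * s)\<^sup>2 / 4) = 1 / real n ^ (q + 2)"
      proof -
        have As: "A * s = 2 * sqrt (real (q + 2) * ln (real n))" by (simp add: A_def s_def real_sqrt_mult)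
        show ?thesis unfolding As by (rule exp_log_tail) (use n in simp)
      qed
      then have "normal_tail_const * exp (- (A * s)\<^sup>2 / 4) = normal_tail_const / real n ^ q / (real n)\<^sup>2"
        by (simp add: power_add power2_eq_square)
      also have "\<dots> \<le> normal_tail_const / 2 ^ q / (real n)\<^sup>2"
        using n normal_tail_const_ge_1 by (intro divide_right_mono divide_left_mono power_mono) auto
      also have "\<dots> \<le> c0 / (2 * C) / (real n)\<^sup>2"
        using q c0(1) C(1) by (intro divide_right_mono) (auto simp: field_simps)
      also have "\<dots> \<le> sd n / (2 * C) / (n * s)"
        using c0 C(1) n s sn sd_nonneg by (intro frac_le divide_right_mono) (auto simp: power2_eq_square)
      finally show ?thesis by (simp add: x_def)
    qed
    finally have "1 / (2 * C) * x \<le> exp (t * (t + A * s)) * stay_le b n" by (simp add: field_simps)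
    also have "exp (t * (t + A * s)) = exp (t\<^sup>2) * exp (t * A * s)"
      by (simp add: exp_add[symmetric] power2_eq_square algebra_simps)
    finally have "1 / (2 * C * exp (t\<^sup>2)) * x * exp (- (t * A * s)) \<le> stay_le b n"
      using C(1) by (simp add: exp_minus field_simps)
    moreover have "1 / c * x * exp (- c * s) \<le> 1 / (2 * C * exp (t\<^sup>2)) * x * exp (- (t * A * s))"
    proof (intro mult_mono)
      have "2 * C * exp (t\<^sup>2) \<le> c" unfolding c_def using t(1) A by simp
      then show "1 / c \<le> 1 / (2 * C * exp (t\<^sup>2))" using C(1) by (intro frac_le) auto
      have "t * A * s \<le> c * s" unfolding c_def using C(1) s by (intro mult_right_mono) auto
      then show "exp (- c * s) \<le> exp (- (t * A * s))" by simp
    qed (use x C(1) in auto)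
    ultimately show ?thesis by (simp add: x_def s_def)
  qed
  then show ?thesis using that cpos by blast
qed

lemma stay_le_bounds_association:
  assumes nn: "\<And>k. 0 \<le> expectation (\<lambda>\<omega>. X 1 \<omega> * (Z (1 + k) \<omega> - Z 1 \<omega>))"
  obtains c :: real where "c > 0" "\<And>n. n \<ge> 1 \<Longrightarrow> stay_le b n \<le> c * (sd n / n)"
    "\<And>n. n \<ge> 2 \<Longrightarrow> 1 / c * (sd n / (n * sqrt (ln n))) \<le> stay_le b n"
proof -
  obtain C1 :: real where C1: "C1 > 0" "\<And>n. n \<ge> 1 \<Longrightarrow> stay_le (- 1) n \<le> C1 * (sd n / n)"
    using stay_le_upper[of 1] by auto
  obtain C2 :: real where C2: "C2 > 0" "\<And>n. n \<ge> 2 \<Longrightarrow> 1 / C2 * (sd n / (n * sqrt (ln n))) \<le> stay_neg n"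
    using stay_neg_lower by blast
  define F where "F u = measure std_normal_distribution {..u}" for u :: real
  have F: "0 < F u" for u unfolding F_def by (rule std_normal_halfline_pos)
  \<comment> \<open>A first step of at most \<open>u1\<close> brings a path from the barrier b below
    -1, whatever the sign of b, since both \<open>u1\<close> and \<open>u1 + b\<close> are at most
    -1.\<close>
  define u1 where "u1 = min (- 1) (- 1 - b)"
  define c where "c = max (C1 / F u1) (C2 / F b)"
  have c: "c > 0" unfolding c_def using C1(1) F[of u1] by (simp add: less_max_iff_disj)
  have "stay_le b n \<le> c * (sd n / n)" if n: "n \<ge> 1" for n
  proof -
    have "F u1 * stay_le b n \<le> stay_le (- 1) n"
      unfolding F_def by (rule stay_le_association[OF nn]) (auto simp: u1_def)
    also have "\<dots> \<le> C1 * (sd n / n)" by (rule C1(2)[OF n])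
    finally have "stay_le b n \<le> (C1 * (sd n / n)) / F u1" using F[of u1] by (simp only: pos_le_divide_eq mult.commute)
    also have "\<dots> = C1 / F u1 * (sd n / n)" by simp
    also have "\<dots> \<le> c * (sd n / n)" using sd_nonneg by (intro mult_right_mono) (auto simp: c_def)
    finally show ?thesis .
  qed
  moreover have "1 / c * (sd n / (n * sqrt (ln n))) \<le> stay_le b n" if n: "n \<ge> 2" for n
  proof -
    have "C2 / F b \<le> c" by (simp add: c_def)
    then have "1 / c \<le> 1 / (C2 / F b)" using C2(1) F[of b] c by (intro divide_left_mono) auto
    then have "1 / c * (sd n / (n * sqrt (ln n))) \<le> F b / C2 * (sd n / (n * sqrt (ln n)))"
      using sd_nonneg n by (intro mult_right_mono) auto
    also have "\<dots> = F b * (1 / C2 * (sd n / (n * sqrt (ln n))))" by simp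
    also have "\<dots> \<le> F b * stay_le 0 n"
      using C2(2)[OF n] stay_neg_le[of 0 n] F[of b] by (intro mult_left_mono) auto
    \<comment> \<open>A first step of at most b followed by a walk staying below 0.\<close>
    also have "\<dots> \<le> stay_le b n"
      unfolding F_def by (rule stay_le_association[OF nn]) auto
    finally show ?thesis .
  qed
  ultimately show ?thesis using that c by blast
qed

end

section \<open>Growth along powers of two and the theorem\<close>

lemma slowly_varying_dyadic_growth:
  fixes d :: "nat \<Rightarrow> real"
  assumes "slowly_varying l" "0 < H" and d: "\<And>j. 0 \<le> d j" "\<And>j. (d j)\<^sup>2 = (2 ^ j) powr (2 * H) * l (2 ^ j)"
  shows "\<forall>\<^sub>F j in sequentially. 0 < d j \<and> 2 powr (H / 2) * d j \<le> d (Suc j)"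
proof -
  have two: "filterlim (\<lambda>j::nat. 2 ^ j :: real) at_top sequentially"
    by (rule filterlim_at_top_mono[OF filterlim_real_sequentially]) (auto intro!: always_eventually less_imp_le of_nat_less_two_power)
  have "\<forall>\<^sub>F t in at_top. l t > 0" "((\<lambda>t. l (2 * t) / l t) \<longlongrightarrow> 1) at_top"
    using assms(1) by (auto simp: slowly_varying_def)
  from eventually_compose_filterlim[OF this(1) two] filterlim_compose[OF this(2) two]
  have pos: "\<forall>\<^sub>F j in sequentially. l (2 ^ j) > 0" and lim: "(\<lambda>j. l (2 * 2 ^ j) / l (2 ^ j)) \<longlonglongrightarrow> 1" by auto
  \<comment> \<open>The quotient of consecutive dyadic values of \<open>l\<close> tends to 1;
    bounding it below by \<open>2 powr (- H)\<close> keeps the factor \<open>2 powr H\<close> for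
    the squares and hence \<open>2 powr (H / 2)\<close> for \<open>d\<close>.\<close>
  have "2 powr (- H) < (1::real)" using assms(2) powr_less_cancel_iff[of 2 "- H" 0] by simp
  from order_tendstoD(1)[OF lim this] pos show ?thesis
  proof eventually_elim
    case (elim j)
    have dj: "0 < (d j)\<^sup>2" unfolding d(2) using elim by simp
    have "2 powr (- H) * l (2 ^ j) \<le> l (2 ^ Suc j)" using elim by (simp add: field_simps)
    then have "(2 ^ Suc j) powr (2 * H) * (2 powr (- H) * l (2 ^ j)) \<le> (d (Suc j))\<^sup>2"
      unfolding d(2) by (intro mult_left_mono) auto
    also have "(2 ^ Suc j :: real) powr (2 * H) * (2 powr (- H) * l (2 ^ j)) = 2 powr H * (d j)\<^sup>2"
    proof -
      have "(2 ^ Suc j :: real) powr (2 * H) = 2 powr (2 * H) * (2 ^ j) powr (2 * H)"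
        by (simp add: powr_mult)
      moreover have "(2::real) powr (2 * H) * 2 powr (- H) = 2 powr H" by (simp add: powr_add[symmetric])
      ultimately show ?thesis unfolding d(2) by (simp add: mult_ac)
    qed
    also have "2 powr H * (d j)\<^sup>2 = (2 powr (H / 2) * d j)\<^sup>2"
      by (simp add: power_mult_distrib powr_power)
    finally have "2 powr (H / 2) * d j \<le> d (Suc j)" by (rule power2_le_imp_le) (rule d(1))
    moreover have "0 < d j" using dj d(1)[of j] by (simp add: less_le)
    ultimately show ?case by simp
  qed
qed

theorem theorem11:
  fixes M :: "'a measure" and X :: "nat \<Rightarrow> 'a \<Rightarrow> real"
    and r :: "int \<Rightarrow> real" and H :: real and l :: "real \<Rightarrow> real"
  assumes prob: "prob_space M"
    and gaussian: "gaussian_sequence M X"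
    and stationary: "stationary_sequence M X"
    and centered: "\<And>k. prob_space.expectation M (X k) = 0"
    and variance_one: "\<And>k. prob_space.variance M (X k) = 1"
    and correlation: "\<And>k j. r (int j) = prob_space.expectation M (\<lambda>\<omega>. X k \<omega> * X (k + j) \<omega>)"
    and r_even: "\<And>j. r (- j) = r j"
    and H: "0 < H" "H < 1"
    and slow: "slowly_varying l"
    and variance_sum: "\<And>n::nat. n \<ge> 1 \<Longrightarrow>
       (\<Sum>i=1..n. \<Sum>j=1..n. r (int i - int j)) = real n powr (2 * H) * l (real n)"
  shows
    "(\<forall>a>0. \<exists>c>0.
        (\<forall>n\<ge>2. 1 / c * real n powr (- (1 - H)) * (sqrt (l (real n)) / sqrt (ln (real n)))
                 \<le> measure M {\<omega> \<in> space M. running_max X n \<omega> < 0}) \<and>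
        (\<forall>n\<ge>1. measure M {\<omega> \<in> space M. running_max X n \<omega> \<le> - a}
                 \<le> c * real n powr (- (1 - H)) * sqrt (l (real n))))
   \<and> (INF n\<in>{1::nat..}. ereal (\<Sum>i=1..n. r (int i - 1)))
       = (INF n\<in>{1::nat..}. ereal (prob_space.expectation M
                                     (\<lambda>\<omega>. partial_sum X 1 \<omega> * partial_sum X n \<omega>)))
   \<and> ((INF n\<in>{1::nat..}. ereal (\<Sum>i=1..n. r (int i - 1))) > 0 \<longrightarrow>
      (\<forall>b. \<exists>c>0.
        (\<forall>n\<ge>2. 1 / c * real n powr (- (1 - H)) * (sqrt (l (real n)) / sqrt (ln (real n)))
                   * exp (- c * sqrt (ln (real n)))
                 \<le> measure M {\<omega> \<in> space M. running_max X n \<omega> \<le> b}) \<and>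
        (\<forall>n\<ge>1. measure M {\<omega> \<in> space M. running_max X n \<omega> \<le> b}
                 \<le> real n powr (- (1 - H)) * sqrt (l (real n)) * exp (c * sqrt (ln (real n))))))
   \<and> ((\<forall>j. r j \<ge> 0) \<longrightarrow>
      (\<forall>b. \<exists>c>0.
        (\<forall>n\<ge>2. 1 / c * real n powr (- (1 - H)) * (sqrt (l (real n)) / sqrt (ln (real n)))
                 \<le> measure M {\<omega> \<in> space M. running_max X n \<omega> \<le> b}) \<and>
        (\<forall>n\<ge>1. measure M {\<omega> \<in> space M. running_max X n \<omega> \<le> b}
                 \<le> c * real n powr (- (1 - H)) * sqrt (l (real n)))))"
proof -
  interpret prob_space M by fact
  interpret gaussian_walk M X
  proof
    show "expectation (\<lambda>\<omega>. (X k \<omega>)\<^sup>2) = 1" for k using variance_one[of k] centered[of k] by simp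
  qed fact+
  have cov: "expectation (\<lambda>\<omega>. X i \<omega> * X j \<omega>) = r (int i - int j)" for i j
  proof (cases "j \<le> i")
    case True
    then show ?thesis using correlation[of "i - j" j] by (simp add: of_nat_diff mult.commute)
  next
    case False
    then show ?thesis using correlation[of "j - i" i] r_even[of "int i - int j"] by (simp add: of_nat_diff)
  qed
  have iX: "integrable M (\<lambda>\<omega>. X i \<omega> * X j \<omega>)" for i j
    by (intro lin_integrable_mult lin_X)
  have covZ: "expectation (\<lambda>\<omega>. X 1 \<omega> * Z n \<omega>) = (\<Sum>i=1..n. r (int i - 1))" for n
  proof -
    have "r (int i - 1) = expectation (\<lambda>\<omega>. X 1 \<omega> * X i \<omega>)" for i
      using cov[of i 1] by (simp add: mult.commute)
    then show ?thesis using iX by (simp add: partial_sum_def sum_distrib_left)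
  qed
  have sd2: "(sd n)\<^sup>2 = real n powr (2 * H) * l (real n)" if "n \<ge> 1" for n
  proof -
    have "(sd n)\<^sup>2 = expectation (\<lambda>\<omega>. (Z n \<omega>)\<^sup>2)" by (simp add: sd_def)
    also have "\<dots> = expectation (\<lambda>\<omega>. \<Sum>i=1..n. \<Sum>j=1..n. X i \<omega> * X j \<omega>)"
      by (simp add: partial_sum_def power2_eq_square sum_product)
    also have "\<dots> = (\<Sum>i=1..n. \<Sum>j=1..n. r (int i - int j))"
      using iX by (simp add: cov)
    finally show ?thesis using variance_sum[OF that] by simp
  qed
  define \<rho> where "\<rho> = (2::real) powr (H / 2)"
  have \<rho>: "1 < \<rho>" unfolding \<rho>_def using H by simp
  have "\<forall>\<^sub>F j in sequentially. 0 < sd (2 ^ j) \<and> \<rho> * sd (2 ^ j) \<le> sd (2 ^ Suc j)"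
    unfolding \<rho>_def by (rule slowly_varying_dyadic_growth[OF slow H(1)]) (auto simp: sd_nonneg sd2)
  then obtain s where s: "\<And>j. j \<ge> s \<Longrightarrow> 0 < sd (2 ^ j)" "\<And>j. j \<ge> s \<Longrightarrow> \<rho> * sd (2 ^ j) \<le> sd (2 ^ Suc j)"
    by (auto simp: eventually_sequentially)
  \<comment> \<open>Positivity at large scales passes down by subadditivity: a vanishing deviation
    at \<open>2 ^ j\<close> would vanish at all multiples.\<close>
  have "0 < sd (2 ^ j)" for j
  proof -
    have "0 < sd (2 ^ s * 2 ^ j)" using s(1)[of "s + j"] by (simp add: power_add)
    also have "\<dots> \<le> real (2 ^ s) * sd (2 ^ j)" by (rule sd_mult)
    finally show ?thesis by (simp add: zero_less_mult_iff)
  qed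
  moreover have "\<rho> > 0" using \<rho> by simp
  ultimately obtain C0 where C0: "C0 \<ge> 1" "\<And>j m. j \<le> m \<Longrightarrow> \<rho> ^ (m - j) * sd (2 ^ j) \<le> C0 * sd (2 ^ m)"
    using geometric_growth[of "\<lambda>j. sd (2 ^ j)" \<rho> s] s(2) by blast
  interpret growing_gaussian_walk M X \<rho> C0
    by unfold_locales (use \<rho> C0 in auto)
  \<comment> \<open>The target rate is \<open>sd n / n\<close>; this replaces H and \<open>l\<close>
    in all the bounds.\<close>
  have rate: "real n powr (- (1 - H)) * sqrt (l (real n)) = sd n / n" if n: "n \<ge> 1" for n
  proof -
    have "sd n = sqrt (real n powr (2 * H) * l (real n))"
      using sd2[OF n] sd_nonneg[of n] by (metis real_sqrt_unique)
    also have "\<dots> = real n powr H * sqrt (l (real n))"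
      using n by (simp add: real_sqrt_mult powr_half_sqrt[symmetric] powr_powr)
    finally show ?thesis using n by (simp add: powr_diff field_simps)
  qed
  have rate_ln: "real n powr (- (1 - H)) * (sqrt (l (real n)) / sqrt (ln (real n))) = sd n / (n * sqrt (ln n))"
    if n: "n \<ge> 2" for n
    using rate[of n] n by (metis (no_types) divide_divide_eq_left one_le_numeral order_trans times_divide_eq_right)
  have mult_rate: "z * real n powr (- (1 - H)) * sqrt (l (real n)) = z * (sd n / n)" if "n \<ge> 1" for n z
    unfolding mult.assoc rate[OF that] ..
  have mult_rate_ln: "z * real n powr (- (1 - H)) * (sqrt (l (real n)) / sqrt (ln (real n))) = z * (sd n / (n * sqrt (ln n)))"
    if "n \<ge> 2" for n z
    unfolding mult.assoc rate_ln[OF that] ..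
  have neg: "measure M {\<omega> \<in> space M. running_max X n \<omega> < 0} = stay_neg n" if "n \<ge> 1" for n
    using that by (auto simp: stay_neg_def running_max_def intro!: arg_cong[of _ _ prob])
  have le: "measure M {\<omega> \<in> space M. running_max X n \<omega> \<le> b} = stay_le b n" if "n \<ge> 1" for n b
    using that by (auto simp: stay_le_def running_max_def intro!: arg_cong[of _ _ prob])
  have part1: "\<exists>c>0. (\<forall>n\<ge>2. 1 / c * real n powr (- (1 - H)) * (sqrt (l (real n)) / sqrt (ln (real n)))
                 \<le> measure M {\<omega> \<in> space M. running_max X n \<omega> < 0}) \<and>
        (\<forall>n\<ge>1. measure M {\<omega> \<in> space M. running_max X n \<omega> \<le> - a}
                 \<le> c * real n powr (- (1 - H)) * sqrt (l (real n)))" if a: "a > 0" for a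
  proof -
    obtain C1 :: real where C1: "C1 > 0" "\<And>n. n \<ge> 1 \<Longrightarrow> stay_le (- a) n \<le> C1 * (sd n / n)"
      using stay_le_upper[OF a] by blast
    obtain C2 :: real where C2: "C2 > 0" "\<And>n. n \<ge> 2 \<Longrightarrow> 1 / C2 * (sd n / (n * sqrt (ln n))) \<le> stay_neg n"
      using stay_neg_lower by blast
    define c where "c = max C1 C2"
    have c: "c > 0" "C1 \<le> c" "1 / c \<le> 1 / C2" using C1(1) C2(1) by (auto simp: c_def intro!: divide_left_mono)
    have lower: "1 / c * (sd n / (n * sqrt (ln n))) \<le> stay_neg n" if "n \<ge> 2" for n
      using C2(2)[OF that] mult_right_mono[OF c(3), of "sd n / (n * sqrt (ln n))"] sd_nonneg[of n] that by simp
    have upper: "stay_le (- a) n \<le> c * (sd n / n)" if "n \<ge> 1" for n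
      using C1(2)[OF that] mult_right_mono[OF c(2), of "sd n / n"] sd_nonneg[of n] by simp
    show ?thesis
    proof (intro exI[of _ c] conjI allI impI)
      fix n :: nat
      assume n: "2 \<le> n"
      then have n1: "1 \<le> n" by simp
      show "1 / c * real n powr (- (1 - H)) * (sqrt (l (real n)) / sqrt (ln (real n)))
         \<le> measure M {\<omega> \<in> space M. running_max X n \<omega> < 0}"
        unfolding mult_rate_ln[OF n] neg[OF n1] using lower[OF n] .
    next
      fix n :: nat
      assume n: "1 \<le> n"
      show "measure M {\<omega> \<in> space M. running_max X n \<omega> \<le> - a} \<le> c * real n powr (- (1 - H)) * sqrt (l (real n))"
        unfolding mult_rate[OF n] le[OF n] using upper[OF n] .
    qed (rule c(1))
  qed
  have part3: "\<exists>c>0. (\<forall>n\<ge>2. 1 / c * real n powr (- (1 - H)) * (sqrt (l (real n)) / sqrt (ln (real n)))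
                   * exp (- c * sqrt (ln (real n)))
                 \<le> measure M {\<omega> \<in> space M. running_max X n \<omega> \<le> b}) \<and>
        (\<forall>n\<ge>1. measure M {\<omega> \<in> space M. running_max X n \<omega> \<le> b}
                 \<le> real n powr (- (1 - H)) * sqrt (l (real n)) * exp (c * sqrt (ln (real n))))"
    if inf: "(INF n\<in>{1::nat..}. ereal (\<Sum>i=1..n. r (int i - 1))) > 0" for b
  proof -
    \<comment> \<open>The infimum is taken in the extended reals, whereas the drift lemmas need a
      real lower bound \<kappa>.\<close>
    obtain e where e: "ereal 0 < ereal e" "ereal e \<le> (INF n\<in>{1::nat..}. ereal (\<Sum>i=1..n. r (int i - 1)))"
      using ereal_dense2[of 0, OF inf] by (metis less_imp_le zero_ereal_def)
    have \<kappa>: "0 < e" "\<And>k. k \<ge> 1 \<Longrightarrow> e \<le> expectation (\<lambda>\<omega>. X 1 \<omega> * Z k \<omega>)"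
      using e(1) order_trans[OF e(2) INF_lower] unfolding covZ by (auto simp flip: ereal_less_eq(3))
    obtain C1 :: real where C1: "C1 > 0" "\<And>n. n \<ge> 1 \<Longrightarrow> stay_le b n \<le> sd n / n * exp (C1 * sqrt (ln n))"
      using stay_le_upper_drift[OF \<kappa>] by blast
    obtain C2 :: real where C2: "C2 > 0" "\<And>n. n \<ge> 2 \<Longrightarrow> 1 / C2 * (sd n / (n * sqrt (ln n))) * exp (- C2 * sqrt (ln n)) \<le> stay_le b n"
      using stay_le_lower_drift[OF \<kappa>] by blast
    define c where "c = max C1 C2"
    have c: "c > 0" "C1 \<le> c" "C2 \<le> c" "1 / c \<le> 1 / C2" using C1(1) C2(1) by (auto simp: c_def intro!: divide_left_mono)
    have lower: "1 / c * (sd n / (n * sqrt (ln n))) * exp (- c * sqrt (ln n)) \<le> stay_le b n" if n: "n \<ge> 2" for n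
    proof -
      have "1 / c * (sd n / (n * sqrt (ln n))) * exp (- c * sqrt (ln n)) \<le>
            1 / C2 * (sd n / (n * sqrt (ln n))) * exp (- C2 * sqrt (ln n))"
        using c C2(1) n sd_nonneg[of n] by (intro mult_mono) (auto intro!: mult_right_mono)
      then show ?thesis using C2(2)[OF n] by linarith
    qed
    have upper: "stay_le b n \<le> sd n / n * exp (c * sqrt (ln n))" if n: "n \<ge> 1" for n
    proof -
      have "sd n / n * exp (C1 * sqrt (ln n)) \<le> sd n / n * exp (c * sqrt (ln n))"
        using c n sd_nonneg[of n] by (intro mult_left_mono) (auto intro!: mult_right_mono)
      then show ?thesis using C1(2)[OF n] by linarith
    qed
    show ?thesis
    proof (intro exI[of _ c] conjI allI impI)
      fix n :: nat
      assume n: "2 \<le> n"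
      then have n1: "1 \<le> n" by simp
      show "1 / c * real n powr (- (1 - H)) * (sqrt (l (real n)) / sqrt (ln (real n))) * exp (- c * sqrt (ln (real n)))
         \<le> measure M {\<omega> \<in> space M. running_max X n \<omega> \<le> b}"
        unfolding mult_rate_ln[OF n] le[OF n1] using lower[OF n] .
    next
      fix n :: nat
      assume n: "1 \<le> n"
      show "measure M {\<omega> \<in> space M. running_max X n \<omega> \<le> b} \<le> real n powr (- (1 - H)) * sqrt (l (real n)) * exp (c * sqrt (ln (real n)))"
        unfolding rate[OF n] le[OF n] using upper[OF n] .
    qed (rule c(1))
  qed
  have part4: "\<exists>c>0. (\<forall>n\<ge>2. 1 / c * real n powr (- (1 - H)) * (sqrt (l (real n)) / sqrt (ln (real n)))
                 \<le> measure M {\<omega> \<in> space M. running_max X n \<omega> \<le> b}) \<and>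
        (\<forall>n\<ge>1. measure M {\<omega> \<in> space M. running_max X n \<omega> \<le> b}
                 \<le> c * real n powr (- (1 - H)) * sqrt (l (real n)))" if nn: "\<forall>j. r j \<ge> 0" for b
  proof -
    have "0 \<le> expectation (\<lambda>\<omega>. X 1 \<omega> * (Z (1 + k) \<omega> - Z 1 \<omega>))" for k
    proof -
      have "expectation (\<lambda>\<omega>. X 1 \<omega> * (Z (1 + k) \<omega> - Z 1 \<omega>)) = (\<Sum>i=1..k. expectation (\<lambda>\<omega>. X 1 \<omega> * X (i + 1) \<omega>))"
        unfolding Z_shift sum_distrib_left using iX by (intro Bochner_Integration.integral_sum) auto
      also have "\<dots> \<ge> 0" unfolding cov using nn by (intro sum_nonneg) auto
      finally show ?thesis .
    qed
    from stay_le_bounds_association[OF this, of b]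
    obtain c :: real where c: "c > 0" "\<And>n. n \<ge> 1 \<Longrightarrow> stay_le b n \<le> c * (sd n / n)"
      "\<And>n. n \<ge> 2 \<Longrightarrow> 1 / c * (sd n / (n * sqrt (ln n))) \<le> stay_le b n" by blast
    note upper = c(2) and lower = c(3)
    show ?thesis
    proof (intro exI[of _ c] conjI allI impI)
      fix n :: nat
      assume n: "2 \<le> n"
      then have n1: "1 \<le> n" by simp
      show "1 / c * real n powr (- (1 - H)) * (sqrt (l (real n)) / sqrt (ln (real n)))
         \<le> measure M {\<omega> \<in> space M. running_max X n \<omega> \<le> b}"
        unfolding mult_rate_ln[OF n] le[OF n1] using lower[OF n] .
    next
      fix n :: nat
      assume n: "1 \<le> n"
      show "measure M {\<omega> \<in> space M. running_max X n \<omega> \<le> b} \<le> c * real n powr (- (1 - H)) * sqrt (l (real n))"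
        unfolding mult_rate[OF n] le[OF n] using upper[OF n] .
    qed (rule c(1))
  qed
  have part2: "(INF n\<in>{1::nat..}. ereal (\<Sum>i=1..n. r (int i - 1)))
       = (INF n\<in>{1::nat..}. ereal (expectation (\<lambda>\<omega>. partial_sum X 1 \<omega> * partial_sum X n \<omega>)))"
    using covZ by (simp add: Z_1)
  show ?thesis using part1 part2 part3 part4 by blast
qed

end
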